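(* Consider the stochastic mirror descent iteration $\{x_n^\delta,\xi_n^\delta\}$ with noisy data $y^\delta$ and with the step-sizes $t_n^\delta$ chosen by one of the rules (s1), (s2) or (s3) (all defined in the context). If the integer $n_\delta$ is chosen such that $n_\delta\to\infty$ and $\delta^2 n_\delta\to 0$ as $\delta\to 0$, then $$\mathbb{E}\left[\|x_{n_\delta}^\delta-x^\dagger\|^2\right]\to 0\quad\text{and}\quad \mathbb{E}\left[D_{\mathcal R}^{\xi_{n_\delta}^\delta}(x^\dagger,x_{n_\delta}^\delta)\right]\to 0$$ as $\delta\to 0$.
   Context: Setting. $X$ is a Banach space with dual $X^*$ and duality pairing $\langle\cdot,\cdot\rangle$; $Y_1,\dots,Y_p$ are Hilbert spaces (identified with their duals); $A_i:X\to Y_i$ is a bounded linear operator for $i=1,\dots,p$. $\mathcal R:X\to(-\infty,\infty]$ is proper, lower semi-continuous and strongly convex with modulus of convexity $\sigma>0$, i.e. $\sigma$ is the largest number with $\mathcal R(t\bar x+(1-t)x)+\sigma t(1-t)\|\bar x-x\|^2\le t\mathcal R(\bar x)+(1-t)\mathcal R(x)$ for all $\bar x,x\in\mathrm{dom}(\mathcal R):=\{x:\mathcal R(x)<\infty\}$, $t\in[0,1]$. The system $A_ix=y_i$, $i=1,\dots,p$, has a solution in $\mathrm{dom}(\mathcal R)$; $x^\dagger$ denotes its unique $\mathcal R$-minimizing solution, i.e. the unique solution minimizing $\mathcal R$ among all solutions. For $\xi\in\partial\mathcal R(x)$ (subdifferential), the Bregman distance is $D_{\mathcal R}^{\xi}(\bar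 x,x):=\mathcal R(\bar x)-\mathcal R(x)-\langle\xi,\bar x-x\rangle$. Noisy data. $y^\delta=(y_1^\delta,\dots,y_p^\delta)$, $y_i^\delta\in Y_i$, $\|y_i^\delta-y_i\|\le\delta_i$ with $\delta_i>0$, and $\delta:=(\delta_1^2+\dots+\delta_p^2)^{1/2}$. For $I=\{i_1,\dots,i_b\}\subset\{1,\dots,p\}$ put $Y_I:=Y_{i_1}\times\cdots\times Y_{i_b}$ (product Hilbert space), $A_Ix:=(A_{i_1}x,\dots,A_{i_b}x)$, $y_I^\delta:=(y_{i_1}^\delta,\dots,y_{i_b}^\delta)$, $\delta_I:=(\sum_{i\in I}\delta_i^2)^{1/2}$, and let $A_I^*:Y_I\to X^*$ be the adjoint of $A_I$. Algorithm (stochastic mirror descent). Fix a batch size $b\in\{1,\dots,p\}$. Let $I_0,I_1,\dots$ be independent random subsets of $\{1,\dots,p\}$, each uniformly distributed over the subsets of cardinality $b$; $\mathbb E$ is the expectation with respect to them. Set $\xi_0^\delta:=0\in X^*$ and for $n\ge0$ let $$x_n^\delta:=\arg\min_{x\in X}\{\mathcal R(x)-\langle\xi_n^\delta,x\rangle\},\qquad \xi_{n+1}^\delta:=\xi_n^\delta-t_n^\delta A_{I_n}^*(A_{I_n}x_n^\delta-y_{I_n}^\delta).$$ The minimizer exists and is unique, and $\xi_n^\delta\in\partial\mathcal R(x_n^\delta)$. Step-size rules (quotients with zero denominator, including $0/0$, are read as $+\infty$): (s1) $t_n^\delta=t_{I_n}$, where the numbers $t_I$ are fixed with $0<t_I<4\sigma/\|A_I\|^2$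 for all $I\subset\{1,\dots,p\}$ with $|I|=b$. (s2) $t_n^\delta=\min\left\{\frac{\mu_0\|A_{I_n}x_n^\delta-y_{I_n}^\delta\|^2}{\|A_{I_n}^*(A_{I_n}x_n^\delta-y_{I_n}^\delta)\|^2},\tilde\mu_1\right\}$, with fixed constants $0<\mu_0<4\sigma$, $\tilde\mu_1>0$. (s3) $t_n^\delta=\min\left\{\frac{\mu_0\|A_{I_n}x_n^\delta-y_{I_n}^\delta\|^2}{\|A_{I_n}^*(A_{I_n}x_n^\delta-y_{I_n}^\delta)\|^2},\tilde\mu_1\right\}$ if $\|A_{I_n}x_n^\delta-y_{I_n}^\delta\|>\tau\delta_{I_n}$, and $t_n^\delta=0$ otherwise, with fixed constants $\tau\ge1$, $0<\mu_0<4\sigma$, $\tilde\mu_1>0$. The limit $\delta\to0$ is taken along any family of noise levels $(\delta_1,\dots,\delta_p)$ with $\delta\to 0$ and corresponding noisy data, with everything else ($X,Y_i,A_i,\mathcal R,y_i,b$ and the constants in the step-size rule) fixed; $n_\delta$ is a deterministic integer attached to each noise level. *)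

theory Defs
  imports "HOL-Probability.Probability"
begin

text \<open>
  The index set \<open>{1, \<dots>, p}\<close> is a finite type \<open>'p\<close>, and the Hilbert spaces \<open>Y\<^sub>i\<close> are closed subspaces
  \<open>Y i\<close> of one real Hilbert space \<open>'y\<close>; every finite family of Hilbert spaces is of this form up to
  isometry, via its orthogonal direct sum.
\<close>

definition effective_domain :: "('x \<Rightarrow> ereal) \<Rightarrow> 'x set" where
  "effective_domain R = {x. R x < \<infinity>}"

definition proper_function :: "('x \<Rightarrow> ereal) \<Rightarrow> bool" where
  "proper_function R \<longleftrightarrow> (\<forall>x. R x \<noteq> -\<infinity>) \<and> effective_domain R \<noteq> {}"

definition lower_semicontinuous :: "('x::topological_space \<Rightarrow> ereal) \<Rightarrow> bool" where
  "lower_semicontinuous R \<longleftrightarrow> (\<forall>x. R x \<le> Liminf (at x) R)"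

definition strong_convexity_ineq :: "('x::real_normed_vector \<Rightarrow> ereal) \<Rightarrow> real \<Rightarrow> bool" where
  "strong_convexity_ineq R s \<longleftrightarrow>
    (\<forall>x' \<in> effective_domain R. \<forall>x \<in> effective_domain R. \<forall>t \<in> {0..1}.
      R (t *\<^sub>R x' + (1 - t) *\<^sub>R x) + ereal (s * t * (1 - t) * (norm (x' - x))\<^sup>2)
        \<le> ereal t * R x' + ereal (1 - t) * R x)"

definition modulus_of_convexity :: "('x::real_normed_vector \<Rightarrow> ereal) \<Rightarrow> real \<Rightarrow> bool" where
  "modulus_of_convexity R \<sigma> \<longleftrightarrow>
    strong_convexity_ineq R \<sigma> \<and> (\<forall>s. strong_convexity_ineq R s \<longrightarrow> s \<le> \<sigma>)"

definition minimizing_solution ::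
    "('x::real_normed_vector \<Rightarrow> ereal) \<Rightarrow> ('p \<Rightarrow> 'x \<Rightarrow>\<^sub>L 'y::real_normed_vector) \<Rightarrow> ('p \<Rightarrow> 'y) \<Rightarrow> 'x" where
  "minimizing_solution R A y = arg_min R (\<lambda>x. \<forall>i. blinfun_apply (A i) x = y i)"

text \<open>The intended use is with \<open>\<xi>\<close> a subgradient of \<open>R\<close> at \<open>x\<close>.\<close>

definition bregman_distance ::
    "('x::real_normed_vector \<Rightarrow> ereal) \<Rightarrow> ('x \<Rightarrow>\<^sub>L real) \<Rightarrow> 'x \<Rightarrow> 'x \<Rightarrow> ereal" where
  "bregman_distance R \<xi> x' x = R x' - R x - ereal (blinfun_apply \<xi> (x' - x))"

text \<open>
  The product Hilbert space \<open>Y\<^sub>I\<close> is the subspace of \<open>'y ^ 'p\<close> (with its Euclidean product norm) of the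
  vectors whose components lie in \<open>Y i\<close> for \<open>i \<in> I\<close> and vanish for \<open>i \<notin> I\<close>.
\<close>

definition batch_vec :: "'p set \<Rightarrow> ('p \<Rightarrow> 'y::zero) \<Rightarrow> 'y ^ 'p" where
  "batch_vec I v = (\<chi> i. if i \<in> I then v i else 0)"

definition batch_op ::
    "('p::finite \<Rightarrow> 'x::real_normed_vector \<Rightarrow>\<^sub>L 'y::real_inner) \<Rightarrow> 'p set \<Rightarrow> 'x \<Rightarrow>\<^sub>L ('y ^ 'p)" where
  "batch_op A I = Blinfun (\<lambda>x. batch_vec I (\<lambda>i. blinfun_apply (A i) x))"

lemma blinfun_apply_batch_op:
  fixes A :: "'p::finite \<Rightarrow> 'x::real_normed_vector \<Rightarrow>\<^sub>L 'y::real_inner"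
  shows "blinfun_apply (batch_op A I) x = batch_vec I (\<lambda>i. blinfun_apply (A i) x)"
proof -
  have "bounded_linear (\<lambda>x. batch_vec I (\<lambda>i. blinfun_apply (A i) x))"
  proof (rule bounded_linear_intro)
    fix x y :: 'x and r :: real
    show "batch_vec I (\<lambda>i. A i (x + y)) = batch_vec I (\<lambda>i. A i x) + batch_vec I (\<lambda>i. A i y)"
      by (auto simp: batch_vec_def vec_eq_iff blinfun.add_right)
    show "batch_vec I (\<lambda>i. A i (r *\<^sub>R x)) = r *\<^sub>R batch_vec I (\<lambda>i. A i x)"
      by (auto simp: batch_vec_def vec_eq_iff blinfun.scaleR_right)
    have "norm (batch_vec I (\<lambda>i. A i x)) \<le> (\<Sum>i\<in>UNIV. norm (batch_vec I (\<lambda>i. A i x) $ i))"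
      by (simp add: norm_vec_def L2_set_le_sum)
    also have "\<dots> \<le> (\<Sum>i\<in>UNIV. norm x * norm (A i))"
    proof (rule sum_mono)
      fix i
      have "norm (A i x) \<le> norm x * norm (A i)"
        using norm_blinfun[of "A i" x] by (simp add: mult.commute)
      thus "norm (batch_vec I (\<lambda>i. A i x) $ i) \<le> norm x * norm (A i)"
        by (auto simp: batch_vec_def)
    qed
    finally show "norm (batch_vec I (\<lambda>i. A i x)) \<le> norm x * (\<Sum>i\<in>UNIV. norm (A i))"
      by (simp add: sum_distrib_left)
  qed
  thus ?thesis
    by (simp add: batch_op_def bounded_linear_Blinfun_apply)
qed

text \<open>The adjoint \<open>T\<^sup>* : Y \<rightarrow> X\<^sup>*\<close> of \<open>T : X \<rightarrow> Y\<close>, where the Hilbert space \<open>Y\<close> is identified with its dual.\<close>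

definition dual_adjoint ::
    "('x::real_normed_vector \<Rightarrow>\<^sub>L 'h::real_inner) \<Rightarrow> 'h \<Rightarrow> ('x \<Rightarrow>\<^sub>L real)" where
  "dual_adjoint T v = blinfun_inner_right v o\<^sub>L T"

definition noise_level :: "('p \<Rightarrow> real) \<Rightarrow> 'p set \<Rightarrow> real" where
  "noise_level \<delta> I = sqrt (\<Sum>i\<in>I. (\<delta> i)\<^sup>2)"

text \<open>Unlike the library's division on \<^typ>\<open>ereal\<close>, this gives \<open>0 / 0 = \<infinity>\<close>.\<close>

definition ext_quotient :: "real \<Rightarrow> real \<Rightarrow> ereal" where
  "ext_quotient a b = (if b = 0 then \<infinity> else ereal (a / b))"

text \<open>
  \<open>Constant_Step t\<close> uses the prescribed step size \<open>t I\<close> for each batch \<open>I\<close>; the parameters of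
  \<open>Adaptive_Step\<close> are \<open>\<mu>\<^sub>0, \<mu>\<^sub>1\<close>, and those of \<open>Threshold_Step\<close> are \<open>\<tau>, \<mu>\<^sub>0, \<mu>\<^sub>1\<close>.
\<close>

datatype 'p step_rule =
    Constant_Step "'p set \<Rightarrow> real"
  | Adaptive_Step real real
  | Threshold_Step real real real

fun admissible_rule ::
    "real \<Rightarrow> nat \<Rightarrow> ('p::finite \<Rightarrow> 'x::real_normed_vector \<Rightarrow>\<^sub>L 'y::real_inner) \<Rightarrow> 'p step_rule \<Rightarrow> bool" where
  "admissible_rule \<sigma> b A (Constant_Step t) \<longleftrightarrow>
     (\<forall>I. card I = b \<longrightarrow> 0 < t I \<and> ereal (t I) < ext_quotient (4 * \<sigma>) ((norm (batch_op A I))\<^sup>2))"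
| "admissible_rule \<sigma> b A (Adaptive_Step \<mu>0 \<mu>1) \<longleftrightarrow> 0 < \<mu>0 \<and> \<mu>0 < 4 * \<sigma> \<and> 0 < \<mu>1"
| "admissible_rule \<sigma> b A (Threshold_Step \<tau> \<mu>0 \<mu>1) \<longleftrightarrow> 1 \<le> \<tau> \<and> 0 < \<mu>0 \<and> \<mu>0 < 4 * \<sigma> \<and> 0 < \<mu>1"

definition adaptive_size ::
    "real \<Rightarrow> real \<Rightarrow> ('x::real_normed_vector \<Rightarrow>\<^sub>L 'h::real_inner) \<Rightarrow> 'h \<Rightarrow> real" where
  "adaptive_size \<mu>0 \<mu>1 T r =
     real_of_ereal (min (ext_quotient (\<mu>0 * (norm r)\<^sup>2) ((norm (dual_adjoint T r))\<^sup>2)) (ereal \<mu>1))"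

text \<open>The step size for the batch \<open>I\<close> with residual \<open>r\<close>.\<close>

fun step_size ::
    "'p step_rule \<Rightarrow> ('p::finite \<Rightarrow> 'x::real_normed_vector \<Rightarrow>\<^sub>L 'y::real_inner) \<Rightarrow> ('p \<Rightarrow> real)
      \<Rightarrow> 'p set \<Rightarrow> 'y ^ 'p \<Rightarrow> real" where
  "step_size (Constant_Step t) A \<delta> I r = t I"
| "step_size (Adaptive_Step \<mu>0 \<mu>1) A \<delta> I r = adaptive_size \<mu>0 \<mu>1 (batch_op A I) r"
| "step_size (Threshold_Step \<tau> \<mu>0 \<mu>1) A \<delta> I r =
     (if norm r > \<tau> * noise_level \<delta> I then adaptive_size \<mu>0 \<mu>1 (batch_op A I) r else 0)"

definition mirror_map :: "('x::real_normed_vector \<Rightarrow> ereal) \<Rightarrow> ('x \<Rightarrow>\<^sub>L real) \<Rightarrow> 'x" where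
  "mirror_map R \<xi> = arg_min (\<lambda>x. R x - ereal (blinfun_apply \<xi> x)) (\<lambda>_. True)"

text \<open>The dual and primal iterates along a fixed sequence \<open>J\<close> of batches, for the data \<open>y\<close>.\<close>

primrec smd_dual ::
    "('x::real_normed_vector \<Rightarrow> ereal) \<Rightarrow> ('p::finite \<Rightarrow> 'x \<Rightarrow>\<^sub>L 'y::real_inner) \<Rightarrow> 'p step_rule
      \<Rightarrow> ('p \<Rightarrow> real) \<Rightarrow> ('p \<Rightarrow> 'y) \<Rightarrow> (nat \<Rightarrow> 'p set) \<Rightarrow> nat \<Rightarrow> ('x \<Rightarrow>\<^sub>L real)" where
  "smd_dual R A rule \<delta> y J 0 = 0"
| "smd_dual R A rule \<delta> y J (Suc n) =
     (let \<xi> = smd_dual R A rule \<delta> y J n;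
          T = batch_op A (J n);
          r = blinfun_apply T (mirror_map R \<xi>) - batch_vec (J n) y
      in \<xi> - step_size rule A \<delta> (J n) r *\<^sub>R dual_adjoint T r)"

definition smd_primal ::
    "('x::real_normed_vector \<Rightarrow> ereal) \<Rightarrow> ('p::finite \<Rightarrow> 'x \<Rightarrow>\<^sub>L 'y::real_inner) \<Rightarrow> 'p step_rule
      \<Rightarrow> ('p \<Rightarrow> real) \<Rightarrow> ('p \<Rightarrow> 'y) \<Rightarrow> (nat \<Rightarrow> 'p set) \<Rightarrow> nat \<Rightarrow> 'x" where
  "smd_primal R A rule \<delta> y J n = mirror_map R (smd_dual R A rule \<delta> y J n)"

text \<open>Independent batches, each uniformly distributed over the index sets of cardinality \<open>b\<close>.\<close>

definition random_batches :: "'w measure \<Rightarrow> nat \<Rightarrow> (nat \<Rightarrow> 'w \<Rightarrow> ('p::finite) set) \<Rightarrow> bool" where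
  "random_batches M b I \<longleftrightarrow>
     prob_space.indep_vars M (\<lambda>_. count_space UNIV) I UNIV \<and>
     (\<forall>n. distr M (count_space UNIV) (I n) = measure_pmf (pmf_of_set {S. card S = b}))"

end

theory Submission
  imports Defs
begin

text \<open>
  Let \<open>x\<^sub>n = mirror_map R \<xi>\<^sub>n\<close>, and let \<open>D\<^sub>n\<close> be the Bregman distance of the \<open>R\<close>-minimizing solution \<open>u\<close>
  from \<open>x\<^sub>n\<close>. As a function of \<open>\<xi>\<close> it is \<open>R\<^sup>*(\<xi>) - \<xi> u + R u\<close>, the gap of the dual problem, and strong
  convexity of \<open>R\<close> makes it smooth; moreover it dominates \<open>\<sigma> \<parallel>x\<^sub>n - u\<parallel>\<^sup>2\<close>. So both claims say that
  \<open>e\<^sub>n = E D\<^sub>n\<close> is small at \<open>n = n\<^sub>\<delta>\<close>. Write \<open>f\<^sub>n = \<parallel>A x\<^sub>n - y\<parallel>\<close> for the residual of the whole system with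
  exact data, and \<open>a\<^sub>n = (E f\<^sub>n\<^sup>2)\<^sup>1\<^sup>/\<^sup>2\<close>. Two inequalities carry the proof, with constants that do not
  depend on the noise.

  First, every step decreases the gap up to the noise: \<open>e\<^sub>n\<^sub>+\<^sub>1 \<le> e\<^sub>n - \<kappa> a\<^sub>n\<^sup>2 + C \<delta>\<^sup>2\<close>. Along a fixed
  sequence of batches this is smoothness of the dual gap (\<open>dual_gap_descent\<close>), with the residual of the
  current batch; that batch is independent of \<open>x\<^sub>n\<close>, and averaging over it recovers a fixed fraction
  of the full residual (\<open>expectation_next_batch\<close>, \<open>full_residual_le_sum_batches\<close>).

  Second, the gap is controlled by the residual: for every \<open>\<epsilon> > 0\<close> there is \<open>L\<close> with
  \<open>e\<^sub>n \<le> \<epsilon> + (L + T \<Sum>\<^sub>j\<^sub><\<^sub>n (a\<^sub>j + \<delta>)) a\<^sub>n\<close>. Indeed \<open>D\<^sub>n = R u - R x\<^sub>n + \<xi>\<^sub>n (x\<^sub>n - u)\<close>. The difference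
  \<open>R u - R x\<^sub>n\<close> is at most \<open>\<epsilon> + L f\<^sub>n\<close>, because the minimal value of \<open>R\<close> over approximate solutions tends
  to \<open>R u\<close> (\<open>minimal_value_lsc\<close>; strong convexity replaces weak compactness here). And \<open>\<xi>\<^sub>n\<close> is a sum
  of \<open>n\<close> images of residuals under adjoints, so that \<open>\<xi>\<^sub>n (x\<^sub>n - u)\<close> involves only \<open>A x\<^sub>n - y\<close>.

  These two inequalities settle the matter (\<open>perturbed_descent_uniform_decay\<close>). While \<open>n \<delta>\<^sup>2 \<le> 1\<close>, the
  first one bounds \<open>\<Sum> a\<^sub>j\<^sup>2\<close>, hence the bracket in the second one is \<open>O(\<surd>n)\<close> by Cauchy-Schwarz. If
  \<open>e\<^sub>n > 2 \<epsilon>\<close> persisted, then \<open>a\<^sub>n\<^sup>2\<close> would be at least a multiple of \<open>1/(n + 1)\<close>, and divergence of the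
  harmonic series contradicts the bound on \<open>\<Sum> a\<^sub>j\<^sup>2\<close>. So \<open>e\<^sub>n \<le> 2 \<epsilon>\<close> occurs before a time that is
  independent of the noise, and from there until \<open>n\<^sub>\<delta>\<close> the gap grows by at most \<open>C n\<^sub>\<delta> \<delta>\<^sup>2 \<rightarrow> 0\<close>. The
  estimates concern the noisy iterates themselves rather than their distance from noise-free ones,
  because under the threshold rule the step sizes jump as the data vary.
\<close>

section \<open>Strongly convex functions\<close>

abbreviation (input) rval :: "('x \<Rightarrow> ereal) \<Rightarrow> 'x \<Rightarrow> real" where
  "rval R x \<equiv> real_of_ereal (R x)"

lemma weighted_Young_inequality:
  fixes a b \<eta> :: real
  assumes "0 < \<eta>"
  shows "a * b \<le> \<eta> * a\<^sup>2 + b\<^sup>2 / (4 * \<eta>)"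
proof -
  have "\<eta> * a\<^sup>2 + b\<^sup>2 / (4 * \<eta>) - a * b = \<eta> * (a - b / (2 * \<eta>))\<^sup>2"
    using assms by (simp add: power2_eq_square field_simps)
  moreover have "0 \<le> \<eta> * (a - b / (2 * \<eta>))\<^sup>2" using assms by simp
  ultimately show ?thesis by linarith
qed

locale strongly_convex_function =
  fixes R :: "'x::banach \<Rightarrow> ereal" and \<sigma> :: real
  assumes proper: "proper_function R"
    and lsc: "lower_semicontinuous R"
    and modulus_pos: "0 < \<sigma>"
    and convexity: "strong_convexity_ineq R \<sigma>"
begin

lemma not_MInf: "R x \<noteq> -\<infinity>"
  using proper by (auto simp: proper_function_def)

lemma eq_rval: "x \<in> effective_domain R \<Longrightarrow> R x = ereal (rval R x)"
  using not_MInf[of x] by (auto simp: effective_domain_def ereal_real)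

lemma le_ereal_imp:
  assumes "R x \<le> ereal c"
  shows "x \<in> effective_domain R" "rval R x \<le> c"
proof -
  show "x \<in> effective_domain R" using assms by (auto simp: effective_domain_def)
  from eq_rval[OF this] assms show "rval R x \<le> c" by (metis ereal_less_eq(3))
qed

lemma segment:
  assumes "u \<in> effective_domain R" "v \<in> effective_domain R" "0 \<le> t" "t \<le> 1"
  shows "t *\<^sub>R u + (1 - t) *\<^sub>R v \<in> effective_domain R"
    and "rval R (t *\<^sub>R u + (1 - t) *\<^sub>R v) + \<sigma> * t * (1 - t) * (norm (u - v))\<^sup>2
           \<le> t * rval R u + (1 - t) * rval R v"
proof -
  let ?z = "t *\<^sub>R u + (1 - t) *\<^sub>R v"
  have "R ?z + ereal (\<sigma> * t * (1 - t) * (norm (u - v))\<^sup>2)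
        \<le> ereal t * R u + ereal (1 - t) * R v"
    using convexity assms unfolding strong_convexity_ineq_def by auto
  also have "\<dots> = ereal (t * rval R u + (1 - t) * rval R v)"
    by (subst (1 2) eq_rval) (use assms in auto)
  finally have le: "R ?z + ereal (\<sigma> * t * (1 - t) * (norm (u - v))\<^sup>2)
        \<le> ereal (t * rval R u + (1 - t) * rval R v)" .
  then show dom: "?z \<in> effective_domain R"
    by (auto simp: effective_domain_def)
  from le show "rval R ?z + \<sigma> * t * (1 - t) * (norm (u - v))\<^sup>2
           \<le> t * rval R u + (1 - t) * rval R v"
    by (subst (asm) eq_rval[OF dom]) simp
qed

lemma eventually_greater:
  assumes "c < R x"
  shows "\<forall>\<^sub>F z in nhds x. c < R z"
proof -
  have "c < Liminf (at x) R"
    using lsc assms unfolding lower_semicontinuous_def by (meson less_le_trans)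
  then have "\<forall>\<^sub>F z in at x. c < R z"
    by (rule less_LiminfD)
  with assms show ?thesis
    by (auto simp: eventually_at_filter elim: eventually_mono)
qed

text \<open>
Sequential lower semicontinuity, with upper bounds that may vary along the sequence.
\<close>

lemma le_limit:
  assumes X: "X \<longlonglongrightarrow> x" and le: "\<And>n. R (X n) \<le> ereal (c n)" and c: "c \<longlonglongrightarrow> c0"
  shows "R x \<le> ereal c0"
proof (rule ccontr)
  assume "\<not> R x \<le> ereal c0"
  then have "ereal c0 < R x" by simp
  then obtain c1 where c1: "ereal c0 < ereal c1" "ereal c1 < R x"
    using ereal_dense2 by blast
  have "\<forall>\<^sub>F n in sequentially. ereal c1 < R (X n)"
    using eventually_greater[OF c1(2)] X by (rule eventually_compose_filterlim)
  moreover have "\<forall>\<^sub>F n in sequentially. c n < c1"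
    using c c1(1) by (intro order_tendstoD(2)[OF c]) simp
  ultimately have "\<forall>\<^sub>F n in sequentially. False"
  proof eventually_elim
    case (elim n)
    with le[of n] show False
      by (metis ereal_less_eq(3) less_le_trans less_le_not_le order_less_imp_le)
  qed
  then show False by simp
qed

text \<open>
Lower semicontinuity bounds \<open>R\<close> from below on a small ball around a point \<open>x1\<close> of the domain.
Convexity along the segment from \<open>x1\<close> to a distant point extends this to a lower bound that decreases
linearly in the distance \<open>d\<close>, and the strong convexity term \<open>\<sigma> d\<^sup>2 / 2\<close> outweighs the linear decrease.
\<close>

lemma bounded_below: "\<exists>m. \<forall>x \<in> effective_domain R. m \<le> rval R x"
proof -
  obtain x1 where x1: "x1 \<in> effective_domain R"
    using proper by (auto simp: proper_function_def)
  have "ereal (rval R x1 - 1) < R x1"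
    by (subst (2) eq_rval[OF x1]) simp
  from eventually_greater[OF this] obtain r where r: "0 < r"
    and ball: "\<And>z. dist z x1 < r \<Longrightarrow> ereal (rval R x1 - 1) < R z"
    unfolding eventually_nhds_metric by blast
  define m where "m = rval R x1 - 1 - 2 / (r\<^sup>2 * \<sigma>)"
  have "m \<le> rval R x" if x: "x \<in> effective_domain R" for x
  proof (cases "dist x x1 < r")
    case True
    have "rval R x1 - 1 \<le> rval R x"
      using ball[OF True] eq_rval[OF x] by (metis ereal_less(2) less_ereal.simps(1) less_imp_le)
    moreover have "0 \<le> 2 / (r\<^sup>2 * \<sigma>)" using modulus_pos by simp
    ultimately show ?thesis unfolding m_def by linarith
  next
    case False
    define d where "d = norm (x - x1)"
    have d: "r \<le> d" using False by (simp add: d_def dist_norm)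
    with r have d0: "0 < d" by simp
    \<comment> \<open>This puts the point of the segment at distance \<open>r / 2\<close> from \<open>x1\<close>.\<close>
    define t where "t = r / (2 * d)"
    have t: "0 < t" "t \<le> 1 / 2" using d d0 r by (auto simp: t_def field_simps)
    define z where "z = t *\<^sub>R x + (1 - t) *\<^sub>R x1"
    have "z - x1 = t *\<^sub>R (x - x1)"
      by (simp add: z_def algebra_simps)
    then have "norm (z - x1) = t * d"
      using t by (simp add: d_def)
    also have "\<dots> < r" using r d0 by (simp add: t_def field_simps)
    finally have "ereal (rval R x1 - 1) < R z"
      by (intro ball) (simp add: dist_norm)
    moreover have zd: "z \<in> effective_domain R"
      unfolding z_def using x x1 t by (intro segment) auto
    ultimately have 1: "rval R x1 - 1 \<le> rval R z"
      using eq_rval[OF zd] by (metis less_ereal.simps(1) less_imp_le)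
    have 2: "rval R z + \<sigma> * t * (1 - t) * d\<^sup>2 \<le> t * rval R x + (1 - t) * rval R x1"
      unfolding z_def d_def using x x1 t by (intro segment) auto
    from 1 2 have "t * (rval R x1 + \<sigma> * (1 - t) * d\<^sup>2) - 1 \<le> t * rval R x"
      by (simp add: algebra_simps)
    then have "rval R x1 + \<sigma> * (1 - t) * d\<^sup>2 - 1 / t \<le> rval R x"
      using t by (simp add: field_simps)
    moreover have "1 / t = 2 * d / r" using d0 r by (simp add: t_def)
    moreover have "\<sigma> * (1 / 2) * d\<^sup>2 \<le> \<sigma> * (1 - t) * d\<^sup>2"
      using t modulus_pos by (intro mult_right_mono mult_left_mono) auto
    \<comment> \<open>Completing the square gives the constant \<open>m\<close>.\<close>
    moreover have "\<sigma> * (1 / 2) * d\<^sup>2 - 2 * d / r + 2 / (r\<^sup>2 * \<sigma>) = \<sigma> / 2 * (d - 2 / (r * \<sigma>))\<^sup>2"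
      using r modulus_pos by (simp add: power2_eq_square field_simps)
    moreover have "0 \<le> \<sigma> / 2 * (d - 2 / (r * \<sigma>))\<^sup>2" using modulus_pos by simp
    ultimately show ?thesis unfolding m_def by linarith
  qed
  then show ?thesis by blast
qed

text \<open>
Compare \<open>u\<close> with \<open>t v + (1 - t) u\<close>, divide the strong convexity inequality by \<open>t\<close>, and let \<open>t\<close> tend
to \<open>0\<close>.
\<close>

lemma quadratic_growth:
  assumes "convex C" and u: "u \<in> C" "u \<in> effective_domain R"
    and least: "\<And>z. z \<in> C \<Longrightarrow> z \<in> effective_domain R \<Longrightarrow> rval R u \<le> rval R z"
    and v: "v \<in> C" "v \<in> effective_domain R"
  shows "rval R u + \<sigma> * (norm (v - u))\<^sup>2 \<le> rval R v"
proof -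
  let ?d = "\<sigma> * (norm (v - u))\<^sup>2"
  have "\<forall>\<^sub>F t in at_right 0. rval R u + (1 - t) * ?d \<le> rval R v"
    unfolding eventually_at_right_field
  proof (intro exI[of _ 1] conjI allI impI)
    fix t :: real assume t: "0 < t" "t < 1"
    let ?z = "t *\<^sub>R v + (1 - t) *\<^sub>R u"
    have "?z \<in> C" using \<open>convex C\<close> u v t by (auto simp: convex_def)
    then have "rval R u \<le> rval R ?z"
      using u v t by (intro least segment) auto
    moreover have "rval R ?z + \<sigma> * t * (1 - t) * (norm (v - u))\<^sup>2
        \<le> t * rval R v + (1 - t) * rval R u"
      using u v t by (intro segment) auto
    ultimately have "t * (rval R u + (1 - t) * ?d) \<le> t * rval R v"
      by (simp add: algebra_simps)
    then show "rval R u + (1 - t) * ?d \<le> rval R v" using t by simp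
  qed simp
  moreover have "((\<lambda>t. rval R u + (1 - t) * ?d) \<longlongrightarrow> rval R u + (1 - 0) * ?d) (at_right 0)"
    by (intro tendsto_intros)
  ultimately show ?thesis
    using tendsto_upperbound[of _ _ "at_right (0::real)" "rval R v"] by fastforce
qed

text \<open>
A minimizing sequence is Cauchy, since the value at the midpoint of two of its members is at least the
infimum and strong convexity turns this into a bound on their distance. This replaces the
weak compactness argument available in reflexive spaces.
\<close>

lemma ex_minimizer:
  assumes C: "convex C" "closed C" and ne: "C \<inter> effective_domain R \<noteq> {}"
  shows "\<exists>u \<in> C \<inter> effective_domain R. \<forall>z \<in> C \<inter> effective_domain R. rval R u \<le> rval R z"
proof -
  let ?D = "C \<inter> effective_domain R"
  define m where "m = (INF z \<in> ?D. rval R z)"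
  have bdd: "bdd_below (rval R ` ?D)"
    using bounded_below by (auto simp: bdd_below_def)
  have m_le: "m \<le> rval R z" if "z \<in> ?D" for z
    unfolding m_def using bdd that by (rule cINF_lower)
  have "\<exists>z \<in> ?D. rval R z < m + 1 / real (Suc n)" for n
  proof -
    have "m < m + 1 / real (Suc n)" by simp
    then show ?thesis
      unfolding m_def using cINF_less_iff[OF ne bdd] by blast
  qed
  then obtain X where X: "\<And>n. X n \<in> ?D" "\<And>n. rval R (X n) < m + 1 / real (Suc n)"
    by metis
  have close: "(norm (X i - X j))\<^sup>2 \<le> 4 / \<sigma> * (1 / real (Suc n))" if "n \<le> i" "n \<le> j" for i j n
  proof -
    let ?z = "(1/2::real) *\<^sub>R X i + (1 - 1/2) *\<^sub>R X j"
    have "?z \<in> C" using C X[of i] X[of j] by (intro convexD) auto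
    moreover have "?z \<in> effective_domain R" using X[of i] X[of j] by (intro segment) auto
    ultimately have "m \<le> rval R ?z" by (intro m_le) auto
    moreover have "rval R ?z + \<sigma> * (norm (X i - X j))\<^sup>2 / 4
        \<le> rval R (X i) / 2 + rval R (X j) / 2"
      using segment(2)[of "X i" "X j" "1/2"] X[of i] X[of j] by simp
    moreover have "1 / real (Suc i) \<le> 1 / real (Suc n)" "1 / real (Suc j) \<le> 1 / real (Suc n)"
      using that by (auto simp: field_simps)
    ultimately have "\<sigma> * (norm (X i - X j))\<^sup>2 / 4 \<le> 1 / real (Suc n)"
      using X(2)[of i] X(2)[of j] by linarith
    then have "\<sigma> * (norm (X i - X j))\<^sup>2 \<le> 4 * (1 / real (Suc n))" by simp
    then show ?thesis using modulus_pos
      by (metis (no_types, lifting) mult.commute pos_le_divide_eq times_divide_eq_left)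
  qed
  have "Cauchy X"
  proof (rule metric_CauchyI)
    fix e :: real assume "0 < e"
    have "(\<lambda>n. 4 / \<sigma> * (1 / real (Suc n))) \<longlonglongrightarrow> 4 / \<sigma> * 0"
      by (intro tendsto_mult_left) (use LIMSEQ_inverse_real_of_nat in \<open>simp add: inverse_eq_divide\<close>)
    then have "\<forall>\<^sub>F n in sequentially. 4 / \<sigma> * (1 / real (Suc n)) < e\<^sup>2"
      using \<open>0 < e\<close> by (intro order_tendstoD(2)) auto
    then obtain n where n: "4 / \<sigma> * (1 / real (Suc n)) < e\<^sup>2"
      using eventually_happens'[OF sequentially_bot] by blast
    have "dist (X i) (X j) < e" if "n \<le> i" "n \<le> j" for i j
      using close[OF that] n \<open>0 < e\<close> by (intro power_less_imp_less_base[of _ 2 e]) (auto simp: dist_norm)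
    then show "\<exists>n. \<forall>i\<ge>n. \<forall>j\<ge>n. dist (X i) (X j) < e" by blast
  qed
  then obtain u where u: "X \<longlonglongrightarrow> u"
    using Cauchy_convergent_iff convergent_def by blast
  have "u \<in> C"
    using C(2) X(1) u by (auto simp: closed_sequential_limits)
  moreover have le: "R u \<le> ereal m"
  proof (rule le_limit[OF u])
    show "R (X n) \<le> ereal (m + 1 / real (Suc n))" for n
      using X[of n] by (subst eq_rval) auto
    show "(\<lambda>n. m + 1 / real (Suc n)) \<longlonglongrightarrow> m"
      using tendsto_add[OF tendsto_const[of m] LIMSEQ_inverse_real_of_nat]
      by (simp add: inverse_eq_divide)
  qed
  ultimately show ?thesis
    using le_ereal_imp[OF le] m_le by (metis IntI order_trans)
qed

lemma effective_domain_tilted: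
  "effective_domain (\<lambda>x. R x - ereal (blinfun_apply \<xi> x)) = effective_domain R"
  unfolding effective_domain_def
proof (intro Collect_cong)
  fix x show "R x - ereal (blinfun_apply \<xi> x) < \<infinity> \<longleftrightarrow> R x < \<infinity>" by (cases "R x") auto
qed

text \<open>
A linear functional changes neither the domain nor the convexity defect, so that every result on
minimizers of \<open>R\<close> applies to the objective \<open>R - \<xi>\<close> of \<open>mirror_map\<close>.
\<close>

lemma tilted: "strongly_convex_function (\<lambda>x. R x - ereal (blinfun_apply \<xi> x)) \<sigma>"
proof
  let ?G = "\<lambda>x. R x - ereal (blinfun_apply \<xi> x)"
  note dom = effective_domain_tilted[of \<xi>]
  have "?G x \<noteq> -\<infinity>" for x
    using not_MInf[of x] by (cases "R x") auto
  then show "proper_function ?G"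
    using proper by (auto simp: proper_function_def dom)
  show "0 < \<sigma>" by (rule modulus_pos)
  show "lower_semicontinuous ?G"
    unfolding lower_semicontinuous_def le_Liminf_iff
  proof (intro allI impI)
    fix x c assume c: "c < ?G x"
    obtain c0 where c0: "c < ereal c0" "ereal c0 < ?G x"
      using ereal_dense2[OF c] by blast
    obtain c1 where c1: "ereal c0 < ereal c1" "ereal c1 < ?G x"
      using ereal_dense2[OF c0(2)] by blast
    have "ereal (c1 + \<xi> x) < R x"
      using c1 by (cases "R x") auto
    then have "\<forall>\<^sub>F z in at x. ereal (c1 + \<xi> x) < R z"
      using eventually_greater eventually_nhds_conv_at by blast
    moreover have "((\<lambda>z. \<xi> z) \<longlongrightarrow> \<xi> x) (at x)"
      by (intro tendsto_intros)
    then have "\<forall>\<^sub>F z in at x. \<xi> z < \<xi> x + (c1 - c0)"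
      using c1 by (intro order_tendstoD(2)) auto
    ultimately show "\<forall>\<^sub>F z in at x. c < ?G z"
    proof eventually_elim
      case (elim z)
      then have "ereal c0 < ?G z" by (cases "R z") auto
      with c0 show ?case by (meson less_trans)
    qed
  qed
  show "strong_convexity_ineq ?G \<sigma>"
    unfolding strong_convexity_ineq_def dom
  proof (intro ballI)
    fix u v and t :: real assume u: "u \<in> effective_domain R" and v: "v \<in> effective_domain R"
      and t: "t \<in> {0..1}"
    let ?z = "t *\<^sub>R u + (1 - t) *\<^sub>R v"
    have z: "?z \<in> effective_domain R"
      and "rval R ?z + \<sigma> * t * (1 - t) * (norm (u - v))\<^sup>2 \<le> t * rval R u + (1 - t) * rval R v"
      using segment[OF u v] t by auto
    moreover have "\<xi> ?z = t * \<xi> u + (1 - t) * \<xi> v"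
      by (simp add: blinfun.add_right blinfun.scaleR_right)
    ultimately show "?G ?z + ereal (\<sigma> * t * (1 - t) * (norm (u - v))\<^sup>2)
        \<le> ereal t * ?G u + ereal (1 - t) * ?G v"
      by (subst (1 2 3) eq_rval, use z u v in \<open>simp_all add: right_diff_distrib\<close>)
  qed
qed

lemma arg_min_minimizes:
  assumes "convex {x. P x}" "closed {x. P x}" and feasible: "\<exists>x \<in> effective_domain R. P x"
  shows "P (arg_min R P)"
    and "arg_min R P \<in> effective_domain R"
    and "\<And>z. P z \<Longrightarrow> z \<in> effective_domain R \<Longrightarrow> rval R (arg_min R P) \<le> rval R z"
proof -
  obtain u where u: "P u" "u \<in> effective_domain R"
    and least: "\<And>z. P z \<Longrightarrow> z \<in> effective_domain R \<Longrightarrow> rval R u \<le> rval R z"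
    using ex_minimizer[of "{x. P x}"] assms by auto
  have least': "R u \<le> R z" if "P z" for z
  proof (cases "z \<in> effective_domain R")
    case True
    then show ?thesis
      using least[OF that True] eq_rval[OF True] eq_rval[OF u(2)] by (metis ereal_less_eq(3))
  next
    case False
    then show ?thesis by (auto simp: effective_domain_def)
  qed
  show "P (arg_min R P)"
    by (rule arg_minI[of P u]) (use u least' in \<open>auto simp: not_less\<close>)
  have eq: "R (arg_min R P) = R u"
    using u least' by (intro arg_min_equality) auto
  then show "arg_min R P \<in> effective_domain R"
    using u by (simp add: effective_domain_def)
  show "rval R (arg_min R P) \<le> rval R z" if "P z" "z \<in> effective_domain R" for z
    using least[OF that] eq by simp
qed

lemma mirror_map_in_domain: "mirror_map R \<xi> \<in> effective_domain R" (is ?dom)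
  and mirror_map_growth: "z \<in> effective_domain R \<Longrightarrow>
    rval R (mirror_map R \<xi>) - \<xi> (mirror_map R \<xi>) + \<sigma> * (norm (z - mirror_map R \<xi>))\<^sup>2
      \<le> rval R z - \<xi> z" (is "_ \<Longrightarrow> ?growth z")
proof -
  let ?G = "\<lambda>x. R x - ereal (blinfun_apply \<xi> x)"
  interpret G: strongly_convex_function ?G \<sigma> by (rule tilted)
  note dom = effective_domain_tilted[of \<xi>]
  have val: "rval ?G x = rval R x - \<xi> x" if "x \<in> effective_domain R" for x
    using eq_rval[OF that] by (metis ereal_minus(1) real_of_ereal.simps(1))
  have "\<exists>x \<in> effective_domain ?G. True"
    using G.proper by (auto simp: proper_function_def)
  from G.arg_min_minimizes(2,3)[OF _ _ this]
  have min: "mirror_map R \<xi> \<in> effective_domain ?G"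
    "\<And>z. z \<in> effective_domain ?G \<Longrightarrow> rval ?G (mirror_map R \<xi>) \<le> rval ?G z"
    by (simp_all add: mirror_map_def)
  from min(1) show d: ?dom by (simp only: dom)
  show "?growth z" if z: "z \<in> effective_domain R" for z
  proof -
    have "rval ?G (mirror_map R \<xi>) + \<sigma> * (norm (z - mirror_map R \<xi>))\<^sup>2 \<le> rval ?G z"
      by (rule G.quadratic_growth[of UNIV]) (use d z min(2) in \<open>auto simp: dom\<close>)
    then show ?thesis by (simp only: val[OF d] val[OF z])
  qed
qed

text \<open>
This expresses that the minimal value of \<open>R\<close> subject to \<open>\<parallel>T z - v\<parallel> \<le> \<rho>\<close> tends to the minimal value
subject to \<open>T z = v\<close> as \<open>\<rho> \<rightarrow> 0\<close>. The minimizers \<open>X n\<close> for \<open>\<rho> = 1 / (n + 1)\<close> have increasing values that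
are bounded by \<open>R u\<close>; by quadratic growth, convergence of the values makes \<open>X\<close> a Cauchy sequence. Its
limit solves \<open>T z = v\<close>, so its value is at least \<open>R u\<close>, and by lower semicontinuity at most the limit of
the values. Points with larger residual are covered by the linear term, as \<open>R\<close> is bounded below.
\<close>

lemma minimal_value_lsc:
  fixes T :: "'x \<Rightarrow>\<^sub>L 'h::real_normed_vector"
  assumes u: "u \<in> effective_domain R" "T u = v"
    and least: "\<And>z. T z = v \<Longrightarrow> z \<in> effective_domain R \<Longrightarrow> rval R u \<le> rval R z"
    and "0 < \<epsilon>"
  shows "\<exists>K\<ge>0. \<forall>z \<in> effective_domain R. rval R u - rval R z \<le> \<epsilon> + K * norm (T z - v)"
proof -
  define C where "C n = {z. norm (T z - v) \<le> 1 / real (Suc n)}" for n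
  have C_vimage: "C n = blinfun_apply T -` cball v (1 / real (Suc n))" for n
    by (auto simp: C_def dist_norm norm_minus_commute)
  have convC: "convex (C n)" for n
    unfolding C_vimage
    by (intro convex_linear_vimage bounded_linear.linear blinfun.bounded_linear_right) auto
  have closedC: "closed (C n)" for n
    unfolding C_vimage
    by (intro continuous_closed_vimage closed_cball) (auto intro!: continuous_intros)
  have u_C: "u \<in> C n" for n using u by (simp add: C_def)
  have "\<exists>z \<in> C n \<inter> effective_domain R. \<forall>z' \<in> C n \<inter> effective_domain R. rval R z \<le> rval R z'" for n
    using u u_C by (intro ex_minimizer convC closedC) auto
  then obtain X where X: "\<And>n. X n \<in> C n" "\<And>n. X n \<in> effective_domain R"
    and X_least: "\<And>n z. z \<in> C n \<Longrightarrow> z \<in> effective_domain R \<Longrightarrow> rval R (X n) \<le> rval R z"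
    by (metis Int_iff)
  have mono_C: "C j \<subseteq> C i" if "i \<le> j" for i j
  proof -
    have "1 / real (Suc j) \<le> 1 / real (Suc i)" using that by (simp add: field_simps)
    then show ?thesis unfolding C_def by (auto intro: order_trans)
  qed
  have growth: "rval R (X i) + \<sigma> * (norm (X j - X i))\<^sup>2 \<le> rval R (X j)" if "i \<le> j" for i j
    by (rule quadratic_growth[OF convC[of i]]) (use X X_least mono_C[OF that] in auto)
  have "incseq (\<lambda>n. rval R (X n))"
  proof (rule incseq_SucI)
    fix n
    show "rval R (X n) \<le> rval R (X (Suc n))"
      using mono_C[of n "Suc n"] X by (intro X_least) auto
  qed
  moreover have bound: "rval R (X n) \<le> rval R u" for n
    using u u_C by (intro X_least)
  ultimately obtain m where m: "(\<lambda>n. rval R (X n)) \<longlonglongrightarrow> m" and m_ub: "\<And>n. rval R (X n) \<le> m"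
    using incseq_convergent[of "\<lambda>n. rval R (X n)" "rval R u"] by blast
  have "Cauchy X"
  proof (rule metric_CauchyI)
    fix e :: real assume "0 < e"
    then have "m - \<sigma> * (e / 2)\<^sup>2 < m" using modulus_pos by simp
    from order_tendstoD(1)[OF m this] obtain n where n: "m - \<sigma> * (e / 2)\<^sup>2 < rval R (X n)"
      using eventually_happens'[OF sequentially_bot] by blast
    have near: "dist (X i) (X n) < e / 2" if "n \<le> i" for i
    proof -
      have "\<sigma> * (norm (X i - X n))\<^sup>2 < \<sigma> * (e / 2)\<^sup>2"
        using growth[OF that] n m_ub[of i] by linarith
      then have "(norm (X i - X n))\<^sup>2 < (e / 2)\<^sup>2"
        using modulus_pos by simp
      then show ?thesis
        using \<open>0 < e\<close> power_less_imp_less_base[of "norm (X i - X n)" 2 "e / 2"]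
        by (simp add: dist_norm)
    qed
    have "dist (X i) (X j) < e" if "n \<le> i" "n \<le> j" for i j
      using near[OF that(1)] near[OF that(2)] by (rule dist_triangle_half_l)
    then show "\<exists>n. \<forall>i\<ge>n. \<forall>j\<ge>n. dist (X i) (X j) < e" by blast
  qed
  then obtain z where z: "X \<longlonglongrightarrow> z"
    using Cauchy_convergent_iff convergent_def by blast
  have "T z = v"
  proof -
    have "(\<lambda>n. T (X n) - v) \<longlonglongrightarrow> T z - v"
      using z by (intro tendsto_intros)
    moreover have "(\<lambda>n. T (X n) - v) \<longlonglongrightarrow> 0"
    proof (rule Lim_null_comparison)
      show "\<forall>\<^sub>F n in sequentially. norm (T (X n) - v) \<le> inverse (real (Suc n))"
        using X(1) by (simp add: C_def inverse_eq_divide)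
      show "(\<lambda>n. inverse (real (Suc n))) \<longlonglongrightarrow> 0" by (rule LIMSEQ_inverse_real_of_nat)
    qed
    ultimately show ?thesis using LIMSEQ_unique by fastforce
  qed
  have "R (X n) \<le> ereal (rval R (X n))" for n
    using eq_rval[OF X(2)[of n]] by simp
  from le_limit[OF z this m] have "z \<in> effective_domain R" "rval R z \<le> m"
    by (rule le_ereal_imp)+
  with least[OF \<open>T z = v\<close>] have "rval R u \<le> m" by simp
  then have "rval R u - \<epsilon> < m" using \<open>0 < \<epsilon>\<close> by simp
  from order_tendstoD(1)[OF m this] obtain n where n: "rval R u - \<epsilon> < rval R (X n)"
    using eventually_happens'[OF sequentially_bot] by blast
  obtain l where l: "\<And>z. z \<in> effective_domain R \<Longrightarrow> l \<le> rval R z"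
    using bounded_below by blast
  define K where "K = real (Suc n) * (rval R u - l)"
  have lu: "l \<le> rval R u" by (rule l[OF u(1)])
  then have "0 \<le> K" by (simp add: K_def)
  moreover have "rval R u - rval R z \<le> \<epsilon> + K * norm (T z - v)" if z: "z \<in> effective_domain R" for z
  proof (cases "z \<in> C n")
    case True
    then have "rval R u - rval R z \<le> \<epsilon>" using X_least[OF True z] n by linarith
    then show ?thesis using \<open>0 \<le> K\<close> by (simp add: add_increasing2)
  next
    case False
    then have "1 \<le> real (Suc n) * norm (T z - v)" by (simp add: C_def field_simps)
    then have "(rval R u - l) * 1 \<le> (rval R u - l) * (real (Suc n) * norm (T z - v))"
      using lu by (intro mult_left_mono) auto
    also have "\<dots> = K * norm (T z - v)" by (simp only: K_def mult_ac)
    finally have "rval R u - l \<le> K * norm (T z - v)" by (simp only: mult_1_right)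
    then show ?thesis using l[OF z] \<open>0 < \<epsilon>\<close> by (simp add: add_increasing)
  qed
  ultimately show ?thesis by blast
qed

text \<open>
This is \<open>R\<^sup>*(\<xi>) - \<xi> u + R u\<close> with the convex conjugate \<open>R\<^sup>*\<close>, that is, the Bregman distance as a function
of the dual variable.
\<close>

definition dual_gap :: "('x \<Rightarrow>\<^sub>L real) \<Rightarrow> 'x \<Rightarrow> real" where
  "dual_gap \<xi> u = (rval R u - \<xi> u) - (rval R (mirror_map R \<xi>) - \<xi> (mirror_map R \<xi>))"

lemma bregman_distance_eq_dual_gap:
  assumes "u \<in> effective_domain R"
  shows "bregman_distance R \<xi> u (mirror_map R \<xi>) = ereal (dual_gap \<xi> u)"
  unfolding bregman_distance_def dual_gap_def
  by (subst (1 2) eq_rval) (use assms mirror_map_in_domain in \<open>auto simp: blinfun.diff_right\<close>)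

lemma norm_le_dual_gap:
  assumes "u \<in> effective_domain R"
  shows "\<sigma> * (norm (mirror_map R \<xi> - u))\<^sup>2 \<le> dual_gap \<xi> u"
  using mirror_map_growth[OF assms, of \<xi>] by (simp add: dual_gap_def norm_minus_commute)

text \<open>
Strong convexity of \<open>R\<close> is smoothness of its conjugate: the gradient of the dual gap at \<open>\<xi>\<close> is
\<open>mirror_map R \<xi> - u\<close>, and it is Lipschitz with constant \<open>1 / (2 \<sigma>)\<close>.
\<close>

lemma dual_gap_smooth:
  "dual_gap \<xi>' u \<le> dual_gap \<xi> u + (\<xi>' - \<xi>) (mirror_map R \<xi> - u) + (norm (\<xi>' - \<xi>))\<^sup>2 / (4 * \<sigma>)"
proof -
  let ?x = "mirror_map R \<xi>" and ?x' = "mirror_map R \<xi>'"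
  let ?s = "norm (\<xi>' - \<xi>)" and ?h = "norm (?x' - ?x)"
  have "(\<xi>' - \<xi>) (?x' - ?x) \<le> ?s * ?h"
    using norm_blinfun[of "\<xi>' - \<xi>" "?x' - ?x"] by simp
  also have "?s * ?h \<le> \<sigma> * ?h\<^sup>2 + ?s\<^sup>2 / (4 * \<sigma>)"
    using weighted_Young_inequality[OF modulus_pos, of ?h ?s] by (simp add: mult.commute)
  finally show ?thesis
    using mirror_map_growth[OF mirror_map_in_domain[of \<xi>'], of \<xi>]
    by (simp add: dual_gap_def blinfun.diff_left blinfun.diff_right)
qed

end

section \<open>Batch operators and noise\<close>

lemma norm_dual_adjoint_le: "norm (dual_adjoint T r) \<le> norm T * norm r"
proof (rule norm_blinfun_bound)
  fix z
  have "norm (dual_adjoint T r z) \<le> norm r * norm (T z)"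
    by (simp add: dual_adjoint_def blinfun_inner_right.rep_eq Cauchy_Schwarz_ineq2)
  also have "\<dots> \<le> norm r * (norm T * norm z)"
    by (intro mult_left_mono norm_blinfun) auto
  finally show "norm (dual_adjoint T r z) \<le> norm T * norm r * norm z" by (simp add: mult_ac)
qed simp

lemma dual_adjoint_apply: "dual_adjoint T r z = r \<bullet> T z"
  by (simp add: dual_adjoint_def blinfun_inner_right.rep_eq)

lemma norm_batch_vec: "(norm (batch_vec S v))\<^sup>2 = (\<Sum>i\<in>S. (norm (v i))\<^sup>2)"
  for v :: "'p::finite \<Rightarrow> 'y::real_normed_vector"
proof -
  have "(norm (batch_vec S v))\<^sup>2 = (\<Sum>i\<in>UNIV. (norm (if i \<in> S then v i else 0))\<^sup>2)"
    by (simp add: norm_vec_def L2_set_def batch_vec_def sum_nonneg)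
  also have "\<dots> = (\<Sum>i\<in>UNIV. if i \<in> S then (norm (v i))\<^sup>2 else 0)"
    by (intro sum.cong) auto
  finally show ?thesis by (simp add: sum.If_cases)
qed

lemma batch_op_residual:
  "batch_op A S x - batch_vec S v = batch_vec S (\<lambda>i. A i x - v i)"
  by (auto simp: blinfun_apply_batch_op batch_vec_def vec_eq_iff)

lemma norm_batch_vec_mono:
  fixes v :: "'p::finite \<Rightarrow> 'y::real_normed_vector"
  assumes "S \<subseteq> S'"
  shows "norm (batch_vec S v) \<le> norm (batch_vec S' v)"
proof (rule power2_le_imp_le)
  show "(norm (batch_vec S v))\<^sup>2 \<le> (norm (batch_vec S' v))\<^sup>2"
    unfolding norm_batch_vec using assms by (intro sum_mono2) auto
qed simp

lemma noise_level_sq: "(noise_level \<delta> S)\<^sup>2 = (\<Sum>i\<in>S. (\<delta> i)\<^sup>2)"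
  by (simp add: noise_level_def sum_nonneg)

lemma noise_level_nonneg: "0 \<le> noise_level \<delta> S"
  by (simp add: noise_level_def sum_nonneg)

lemma noise_level_mono: "S \<subseteq> S' \<Longrightarrow> noise_level \<delta> S \<le> noise_level \<delta> S'" for S' :: "'p::finite set"
  unfolding noise_level_def by (intro real_sqrt_le_mono sum_mono2) auto

lemma norm_batch_noise_le:
  fixes v :: "'p::finite \<Rightarrow> 'y::real_normed_vector"
  assumes "\<And>i. norm (v i) \<le> \<delta> i"
  shows "norm (batch_vec S v) \<le> noise_level \<delta> S"
proof (rule power2_le_imp_le)
  show "(norm (batch_vec S v))\<^sup>2 \<le> (noise_level \<delta> S)\<^sup>2"
    unfolding norm_batch_vec noise_level_sq using assms by (intro sum_mono power_mono) auto
qed (rule noise_level_nonneg)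

section \<open>Step sizes and the descent of the dual gap\<close>

text \<open>
All that the convergence proof needs to know about a step-size rule. The number \<open>q\<close> measures how much
of the smoothness of the dual gap a step uses up, and \<open>q < 1\<close> guarantees descent. The last bound says that
a step is not too short; the term with \<open>K\<close> admits vanishing steps when the residual is of the order of
the noise.
\<close>

definition step_bounds ::
    "real \<Rightarrow> nat \<Rightarrow> ('p::finite \<Rightarrow> 'x::real_normed_vector \<Rightarrow>\<^sub>L 'y::real_inner) \<Rightarrow> 'p step_rule
      \<Rightarrow> real \<Rightarrow> real \<Rightarrow> real \<Rightarrow> real \<Rightarrow> bool" where
  "step_bounds \<sigma> b A rule q T c K \<longleftrightarrow>
    0 \<le> q \<and> q < 1 \<and> 0 \<le> T \<and> 0 < c \<and> 0 \<le> K \<and>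
    (\<forall>\<delta> S r. card S = b \<longrightarrow>
      0 \<le> step_size rule A \<delta> S r \<and> step_size rule A \<delta> S r \<le> T \<and>
      step_size rule A \<delta> S r * (norm (dual_adjoint (batch_op A S) r))\<^sup>2 \<le> 4 * \<sigma> * q * (norm r)\<^sup>2 \<and>
      c * ((norm r)\<^sup>2 - K * (noise_level \<delta> S)\<^sup>2) \<le> step_size rule A \<delta> S r * (norm r)\<^sup>2)"

text \<open>
If the adjoint annihilates the residual, then the quotient is infinite and the step size is \<open>\<mu>\<^sub>1\<close>. Otherwise
\<open>\<parallel>T\<^sup>* r\<parallel> \<le> \<parallel>T\<parallel> \<parallel>r\<parallel>\<close> keeps the quotient above \<open>\<mu>\<^sub>0 / \<parallel>T\<parallel>\<^sup>2\<close>.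
\<close>

lemma adaptive_size_bounds:
  assumes "0 < \<mu>0" "0 < \<mu>1"
  shows "0 \<le> adaptive_size \<mu>0 \<mu>1 T r" "adaptive_size \<mu>0 \<mu>1 T r \<le> \<mu>1"
    and "adaptive_size \<mu>0 \<mu>1 T r * (norm (dual_adjoint T r))\<^sup>2 \<le> \<mu>0 * (norm r)\<^sup>2"
    and "norm T \<le> B \<Longrightarrow> 0 < B \<Longrightarrow> min (\<mu>0 / B\<^sup>2) \<mu>1 * (norm r)\<^sup>2 \<le> adaptive_size \<mu>0 \<mu>1 T r * (norm r)\<^sup>2"
proof -
  let ?g = "norm (dual_adjoint T r)"
  have eq: "adaptive_size \<mu>0 \<mu>1 T r = (if ?g = 0 then \<mu>1 else min (\<mu>0 * (norm r)\<^sup>2 / ?g\<^sup>2) \<mu>1)"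
    by (auto simp: adaptive_size_def ext_quotient_def min_def)
  show "0 \<le> adaptive_size \<mu>0 \<mu>1 T r" "adaptive_size \<mu>0 \<mu>1 T r \<le> \<mu>1"
    using assms unfolding eq by auto
  show "adaptive_size \<mu>0 \<mu>1 T r * ?g\<^sup>2 \<le> \<mu>0 * (norm r)\<^sup>2"
  proof (cases "?g = 0")
    case True
    then show ?thesis using assms by simp
  next
    case False
    then have "0 < ?g\<^sup>2" by simp
    have "adaptive_size \<mu>0 \<mu>1 T r \<le> \<mu>0 * (norm r)\<^sup>2 / ?g\<^sup>2"
      using False unfolding eq by simp
    then show ?thesis using \<open>0 < ?g\<^sup>2\<close> by (simp only: pos_le_divide_eq)
  qed
  show "min (\<mu>0 / B\<^sup>2) \<mu>1 * (norm r)\<^sup>2 \<le> adaptive_size \<mu>0 \<mu>1 T r * (norm r)\<^sup>2"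
    if B: "norm T \<le> B" "0 < B"
  proof (rule mult_right_mono)
    show "min (\<mu>0 / B\<^sup>2) \<mu>1 \<le> adaptive_size \<mu>0 \<mu>1 T r"
    proof (cases "?g = 0")
      case True
      then show ?thesis unfolding eq by simp
    next
      case False
      then have "0 < ?g\<^sup>2" by simp
      have "?g \<le> B * norm r"
        using norm_dual_adjoint_le[of T r] B(1) by (meson mult_right_mono norm_ge_zero order_trans)
      then have "?g\<^sup>2 \<le> (B * norm r)\<^sup>2" by (intro power_mono) auto
      then have "\<mu>0 * ?g\<^sup>2 \<le> \<mu>0 * (B\<^sup>2 * (norm r)\<^sup>2)"
        using assms by (simp add: power_mult_distrib)
      then have "\<mu>0 / B\<^sup>2 \<le> \<mu>0 * (norm r)\<^sup>2 / ?g\<^sup>2"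
        using B(2) \<open>0 < ?g\<^sup>2\<close> by (simp add: divide_simps mult_ac)
      then show ?thesis using False unfolding eq by auto
    qed
  qed simp
qed

text \<open>
The constants are uniform because there are only finitely many batches. For prescribed steps, \<open>q\<close> is the
largest of the quotients \<open>t\<^sub>I \<parallel>A\<^sub>I\<parallel>\<^sup>2 / (4 \<sigma>) < 1\<close>; for the other rules \<open>q = \<mu>\<^sub>0 / (4 \<sigma>)\<close>. The threshold rule
skips a step only if \<open>\<parallel>r\<parallel>\<close> is at most \<open>\<tau>\<close> times the noise level, whence \<open>K = \<tau>\<^sup>2\<close>.
\<close>

lemma admissible_rule_step_bounds:
  fixes A :: "'p::finite \<Rightarrow> 'x::real_normed_vector \<Rightarrow>\<^sub>L 'y::real_inner"
  assumes adm: "admissible_rule \<sigma> b A rule" and "0 < \<sigma>"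
  shows "\<exists>q T c K. step_bounds \<sigma> b A rule q T c K"
proof -
  define B where "B = 1 + (\<Sum>S\<in>UNIV. norm (batch_op A S))"
  have B: "0 < B" by (simp add: B_def add_pos_nonneg sum_nonneg)
  have opB: "norm (batch_op A S) \<le> B" for S
    unfolding B_def using member_le_sum[of S UNIV "\<lambda>S. norm (batch_op A S)"] by simp
  show ?thesis
  proof (cases rule)
    case (Constant_Step t)
    define D where "D = {S::'p set. card S = b}"
    define q where "q = Max (insert 0 ((\<lambda>S. t S * (norm (batch_op A S))\<^sup>2 / (4 * \<sigma>)) ` D))"
    define T where "T = Max (insert 0 (t ` D))"
    define c where "c = Min (insert 1 (t ` D))"
    have t: "0 < t S" "ereal (t S) < ext_quotient (4 * \<sigma>) ((norm (batch_op A S))\<^sup>2)" if "S \<in> D" for S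
      using adm that unfolding Constant_Step D_def by auto
    have t_op: "t S * (norm (batch_op A S))\<^sup>2 / (4 * \<sigma>) < 1" if "S \<in> D" for S
      using t(2)[OF that] \<open>0 < \<sigma>\<close> by (auto simp: ext_quotient_def field_simps split: if_splits)
    have "0 \<le> q" "q < 1" "0 \<le> T" "0 < c"
      using t t_op by (auto simp: q_def T_def c_def)
    moreover have "t S \<le> T" "c \<le> t S" if "S \<in> D" for S
      using that by (auto simp: T_def c_def)
    moreover have "t S * (norm (dual_adjoint (batch_op A S) r))\<^sup>2 \<le> 4 * \<sigma> * q * (norm r)\<^sup>2" if S: "S \<in> D" for S r
    proof -
      have "(norm (dual_adjoint (batch_op A S) r))\<^sup>2 \<le> (norm (batch_op A S))\<^sup>2 * (norm r)\<^sup>2"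
        using power_mono[OF norm_dual_adjoint_le[of "batch_op A S" r], of 2]
        by (simp add: power_mult_distrib)
      then have "t S * (norm (dual_adjoint (batch_op A S) r))\<^sup>2
          \<le> t S * ((norm (batch_op A S))\<^sup>2 * (norm r)\<^sup>2)"
        using t(1)[OF S] by (intro mult_left_mono) auto
      also have "\<dots> = 4 * \<sigma> * (t S * (norm (batch_op A S))\<^sup>2 / (4 * \<sigma>)) * (norm r)\<^sup>2"
        using \<open>0 < \<sigma>\<close> by simp
      also have "\<dots> \<le> 4 * \<sigma> * q * (norm r)\<^sup>2"
        using S \<open>0 < \<sigma>\<close> by (intro mult_right_mono mult_left_mono) (auto simp: q_def)
      finally show ?thesis .
    qed
    ultimately have "step_bounds \<sigma> b A rule q T c 0"
      using t(1) unfolding step_bounds_def Constant_Step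
      by (auto simp: D_def less_imp_le intro!: mult_right_mono)
    then show ?thesis by blast
  next
    case (Adaptive_Step \<mu>0 \<mu>1)
    then have \<mu>: "0 < \<mu>0" "\<mu>0 < 4 * \<sigma>" "0 < \<mu>1" using adm by auto
    have "step_bounds \<sigma> b A rule (\<mu>0 / (4 * \<sigma>)) \<mu>1 (min (\<mu>0 / B\<^sup>2) \<mu>1) 0"
      unfolding step_bounds_def Adaptive_Step
      using \<mu> \<open>0 < \<sigma>\<close> B adaptive_size_bounds(1-3)[OF \<mu>(1,3)]
        adaptive_size_bounds(4)[OF \<mu>(1,3) opB B] by auto
    then show ?thesis by blast
  next
    case (Threshold_Step \<tau> \<mu>0 \<mu>1)
    then have \<mu>: "0 < \<mu>0" "\<mu>0 < 4 * \<sigma>" "0 < \<mu>1" and \<tau>: "1 \<le> \<tau>" using adm by auto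
    have c: "0 < min (\<mu>0 / B\<^sup>2) \<mu>1" using \<mu> B by simp
    have "min (\<mu>0 / B\<^sup>2) \<mu>1 * ((norm r)\<^sup>2 - \<tau>\<^sup>2 * (noise_level \<delta> S)\<^sup>2)
        \<le> step_size rule A \<delta> S r * (norm r)\<^sup>2" for \<delta> S r
    proof (cases "norm r > \<tau> * noise_level \<delta> S")
      case True
      have "min (\<mu>0 / B\<^sup>2) \<mu>1 * ((norm r)\<^sup>2 - \<tau>\<^sup>2 * (noise_level \<delta> S)\<^sup>2)
          \<le> min (\<mu>0 / B\<^sup>2) \<mu>1 * (norm r)\<^sup>2"
        using c by (intro mult_left_mono) auto
      also have "\<dots> \<le> adaptive_size \<mu>0 \<mu>1 (batch_op A S) r * (norm r)\<^sup>2"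
        using adaptive_size_bounds(4)[OF \<mu>(1,3) opB B] .
      finally show ?thesis using True by (simp add: Threshold_Step)
    next
      case False
      then have "(norm r)\<^sup>2 \<le> (\<tau> * noise_level \<delta> S)\<^sup>2" by (intro power_mono) auto
      then have "min (\<mu>0 / B\<^sup>2) \<mu>1 * ((norm r)\<^sup>2 - \<tau>\<^sup>2 * (noise_level \<delta> S)\<^sup>2) \<le> 0"
        using c by (intro mult_nonneg_nonpos) (auto simp: power_mult_distrib)
      then show ?thesis using False by (simp add: Threshold_Step)
    qed
    then have "step_bounds \<sigma> b A rule (\<mu>0 / (4 * \<sigma>)) \<mu>1 (min (\<mu>0 / B\<^sup>2) \<mu>1) (\<tau>\<^sup>2)"
      unfolding step_bounds_def
      using \<mu> \<open>0 < \<sigma>\<close> c adaptive_size_bounds(1,2,3)[OF \<mu>(1,3)] by (auto simp: Threshold_Step)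
    then show ?thesis by blast
  qed
qed

context strongly_convex_function
begin

text \<open>
Insert the update into \<open>dual_gap_smooth\<close>. The linear term gives \<open>- t \<parallel>r\<parallel>\<^sup>2\<close> and a noise term
\<open>t \<parallel>r\<parallel> d\<close>, the quadratic term costs at most \<open>q t \<parallel>r\<parallel>\<^sup>2\<close>. Of the remaining factor \<open>1 - q\<close> one half absorbs the
noise term. Another factor \<open>1/2\<close> is lost in passing from the noisy residual \<open>r\<close> to the exact one.
\<close>

lemma dual_gap_step:
  fixes T :: "'x \<Rightarrow>\<^sub>L 'h::real_inner"
  assumes u: "T u = v" and w: "norm w \<le> d" and t: "0 \<le> t" "t \<le> tmax"
    and q: "0 \<le> q" "q < 1" and c: "0 \<le> c" and K: "0 \<le> K"
    and r: "r = T (mirror_map R \<xi>) - v - w"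
    and up: "t * (norm (dual_adjoint T r))\<^sup>2 \<le> 4 * \<sigma> * q * (norm r)\<^sup>2"
    and low: "c * ((norm r)\<^sup>2 - K * d\<^sup>2) \<le> t * (norm r)\<^sup>2"
  shows "dual_gap (\<xi> - t *\<^sub>R dual_adjoint T r) u
    \<le> dual_gap \<xi> u - (1 - q) * c / 4 * (norm (T (mirror_map R \<xi>) - v))\<^sup>2
       + (tmax / (2 * (1 - q)) + (1 - q) * c * (K + 1) / 2) * d\<^sup>2"
proof -
  let ?x = "mirror_map R \<xi>" and ?\<xi>' = "\<xi> - t *\<^sub>R dual_adjoint T r"
  let ?n = "norm r" and ?g = "norm (T ?x - v)"
  have d: "0 \<le> d" using w norm_ge_zero order_trans by blast
  have pairing: "(?\<xi>' - \<xi>) (?x - u) = - t * (r \<bullet> (r + w))"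
  proof -
    have "T (?x - u) = r + w" using r u by (simp add: blinfun.diff_right)
    moreover have "(?\<xi>' - \<xi>) (?x - u) = - t * dual_adjoint T r (?x - u)"
      by (simp add: blinfun.diff_left blinfun.minus_left blinfun.scaleR_left)
    ultimately show ?thesis by (simp add: dual_adjoint_apply)
  qed
  have "- (r \<bullet> w) \<le> ?n * d"
    using Cauchy_Schwarz_ineq2[of r w] mult_left_mono[OF w, of ?n] by (simp add: abs_le_iff)
  then have "t * - (r \<bullet> w) \<le> t * (?n * d)" using t by (intro mult_left_mono)
  then have pair_le: "(?\<xi>' - \<xi>) (?x - u) \<le> - t * ?n\<^sup>2 + t * (?n * d)"
    unfolding pairing by (simp add: inner_add_right power2_norm_eq_inner algebra_simps)
  have sq: "(norm (?\<xi>' - \<xi>))\<^sup>2 / (4 * \<sigma>) \<le> t * q * ?n\<^sup>2"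
  proof -
    have "(norm (?\<xi>' - \<xi>))\<^sup>2 = t * (t * (norm (dual_adjoint T r))\<^sup>2)"
      by (simp add: power_mult_distrib power2_eq_square)
    also have "\<dots> \<le> t * (4 * \<sigma> * q * ?n\<^sup>2)"
      using t up by (intro mult_left_mono)
    finally show ?thesis using modulus_pos by (simp add: field_simps)
  qed
  have young: "t * (?n * d) \<le> (1 - q) / 2 * (t * ?n\<^sup>2) + tmax / (2 * (1 - q)) * d\<^sup>2"
  proof -
    have "?n * d \<le> (1 - q) / 2 * ?n\<^sup>2 + 1 / (2 * (1 - q)) * d\<^sup>2"
    proof -
      have "4 * ((1 - q) / 2) = 2 * (1 - q)" by simp
      then show ?thesis
        using weighted_Young_inequality[of "(1 - q) / 2" ?n d] q by (simp only:) simp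
    qed
    then have "t * (?n * d) \<le> t * ((1 - q) / 2 * ?n\<^sup>2 + 1 / (2 * (1 - q)) * d\<^sup>2)"
      using t by (intro mult_left_mono)
    also have "\<dots> = (1 - q) / 2 * (t * ?n\<^sup>2) + t * (1 / (2 * (1 - q)) * d\<^sup>2)"
      by (simp add: algebra_simps)
    also have "t * (1 / (2 * (1 - q)) * d\<^sup>2) \<le> tmax * (1 / (2 * (1 - q)) * d\<^sup>2)"
      using t q by (intro mult_right_mono) auto
    finally show ?thesis by simp
  qed
  have "?g\<^sup>2 \<le> 2 * ?n\<^sup>2 + 2 * d\<^sup>2"
  proof -
    have "?g \<le> ?n + d" using r w norm_triangle_ineq[of r w] by simp
    then have "?g\<^sup>2 \<le> (?n + d)\<^sup>2" by (intro power_mono) auto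
    also have "\<dots> \<le> 2 * ?n\<^sup>2 + 2 * d\<^sup>2"
      using zero_le_power2[of "?n - d"] by (simp add: power2_eq_square algebra_simps)
    finally show ?thesis .
  qed
  then have "c * (?g\<^sup>2 / 2 - (K + 1) * d\<^sup>2) \<le> c * (?n\<^sup>2 - K * d\<^sup>2)"
    using c by (intro mult_left_mono) (simp_all add: algebra_simps)
  with low have "c * (?g\<^sup>2 / 2 - (K + 1) * d\<^sup>2) \<le> t * ?n\<^sup>2" by linarith
  then have "(1 - q) / 2 * (c * (?g\<^sup>2 / 2 - (K + 1) * d\<^sup>2)) \<le> (1 - q) / 2 * (t * ?n\<^sup>2)"
    using q by (intro mult_left_mono) auto
  moreover have "(1 - q) / 2 * (c * (?g\<^sup>2 / 2 - (K + 1) * d\<^sup>2))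
      = (1 - q) * c / 4 * ?g\<^sup>2 - (1 - q) * c * (K + 1) / 2 * d\<^sup>2"
    by (simp add: field_simps)
  moreover have "- t * ?n\<^sup>2 + (1 - q) / 2 * (t * ?n\<^sup>2) + t * q * ?n\<^sup>2 = - ((1 - q) / 2 * (t * ?n\<^sup>2))"
    by (simp add: field_simps)
  moreover have "(tmax / (2 * (1 - q)) + (1 - q) * c * (K + 1) / 2) * d\<^sup>2
      = tmax / (2 * (1 - q)) * d\<^sup>2 + (1 - q) * c * (K + 1) / 2 * d\<^sup>2"
    by (rule distrib_right)
  ultimately show ?thesis
    using dual_gap_smooth[of ?\<xi>' u \<xi>] pair_le sq young by linarith
qed

end

lemma residual_norm_le:
  fixes A :: "'p::finite \<Rightarrow> 'x::real_normed_vector \<Rightarrow>\<^sub>L 'y::real_inner"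
  assumes "\<And>i. norm (v i - y i) \<le> \<delta> i"
  shows "norm (batch_op A S x - batch_vec S v)
    \<le> norm (batch_op A UNIV x - batch_vec UNIV y) + noise_level \<delta> UNIV"
proof -
  have "batch_vec S (\<lambda>i. A i x - v i) = batch_vec S (\<lambda>i. A i x - y i) - batch_vec S (\<lambda>i. v i - y i)"
    by (auto simp: batch_vec_def vec_eq_iff)
  then have "norm (batch_vec S (\<lambda>i. A i x - v i))
      \<le> norm (batch_vec S (\<lambda>i. A i x - y i)) + norm (batch_vec S (\<lambda>i. v i - y i))"
    using norm_triangle_ineq4 by metis
  moreover have "norm (batch_vec S (\<lambda>i. A i x - y i)) \<le> norm (batch_vec UNIV (\<lambda>i. A i x - y i))"
    by (rule norm_batch_vec_mono) simp
  moreover have "norm (batch_vec S (\<lambda>i. v i - y i)) \<le> noise_level \<delta> UNIV"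
    using norm_batch_noise_le[of "\<lambda>i. v i - y i" \<delta> S, OF assms] noise_level_mono[of S UNIV \<delta>]
    by (meson order_trans subset_UNIV)
  ultimately show ?thesis unfolding batch_op_residual by linarith
qed

text \<open>
The dual iterate is a combination of vectors \<open>A\<^sub>I\<^sup>* r\<^sub>j\<close>, and \<open>\<langle>A\<^sub>I\<^sup>* r\<^sub>j, z\<rangle> = \<langle>r\<^sub>j, A\<^sub>I z\<rangle>\<close>. So its value at \<open>z\<close> is
controlled by \<open>A z\<close> alone, however large \<open>z\<close> may be.
\<close>

lemma smd_dual_pairing_le:
  fixes A :: "'p::finite \<Rightarrow> 'x::real_normed_vector \<Rightarrow>\<^sub>L 'y::real_inner"
  assumes bounds: "step_bounds \<sigma> b A rule q T c K"
    and J: "\<And>n. card (J n) = b" and noise: "\<And>i. norm (v i - y i) \<le> \<delta> i"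
  shows "\<bar>smd_dual R A rule \<delta> v J n z\<bar>
    \<le> T * (\<Sum>j<n. norm (batch_op A UNIV (smd_primal R A rule \<delta> v J j) - batch_vec UNIV y)
          + noise_level \<delta> UNIV) * norm (batch_op A UNIV z)"
proof (induction n)
  case (Suc n)
  define x where "x = smd_primal R A rule \<delta> v J n"
  define r where "r = batch_op A (J n) x - batch_vec (J n) v"
  define t where "t = step_size rule A \<delta> (J n) r"
  let ?\<rho> = "norm (batch_op A UNIV x - batch_vec UNIV y) + noise_level \<delta> UNIV"
  have t: "0 \<le> t" "t \<le> T"
    using bounds J[of n] unfolding step_bounds_def t_def by auto
  have "smd_dual R A rule \<delta> v J (Suc n) = smd_dual R A rule \<delta> v J n - t *\<^sub>R dual_adjoint (batch_op A (J n)) r"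
    by (simp add: Let_def t_def r_def x_def smd_primal_def)
  then have "\<bar>smd_dual R A rule \<delta> v J (Suc n) z\<bar>
      \<le> \<bar>smd_dual R A rule \<delta> v J n z\<bar> + \<bar>t * (r \<bullet> batch_op A (J n) z)\<bar>"
    by (simp add: blinfun.diff_left blinfun.scaleR_left dual_adjoint_apply abs_triangle_ineq4)
  moreover have "\<bar>t * (r \<bullet> batch_op A (J n) z)\<bar> \<le> T * (?\<rho> * norm (batch_op A UNIV z))"
  proof -
    have "\<bar>r \<bullet> batch_op A (J n) z\<bar> \<le> norm r * norm (batch_op A (J n) z)"
      by (rule Cauchy_Schwarz_ineq2)
    also have "\<dots> \<le> ?\<rho> * norm (batch_op A UNIV z)"
      using residual_norm_le[OF noise, of A "J n" x]
      by (intro mult_mono) (auto simp: r_def blinfun_apply_batch_op noise_level_nonneg intro!: norm_batch_vec_mono)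
    finally show ?thesis unfolding abs_mult using t by (intro mult_mono) auto
  qed
  ultimately show ?case
    using Suc by (simp add: x_def algebra_simps)
qed simp

text \<open>
Every index belongs to some batch of size \<open>b\<close>.
\<close>

lemma full_residual_le_sum_batches:
  fixes w :: "'p::finite \<Rightarrow> 'y::real_normed_vector"
  assumes "1 \<le> b" "b \<le> CARD('p)"
  shows "(norm (batch_vec UNIV w))\<^sup>2 \<le> (\<Sum>S | card S = b. (norm (batch_vec S w))\<^sup>2)"
proof -
  let ?D = "{S :: 'p set. card S = b}"
  have "(norm (w i))\<^sup>2 \<le> (\<Sum>S\<in>?D. if i \<in> S then (norm (w i))\<^sup>2 else 0)" for i
  proof -
    have "b - 1 \<le> card (UNIV - {i})" using assms by (simp add: card_Diff_singleton)
    then obtain S where S: "S \<subseteq> UNIV - {i}" "card S = b - 1"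
      using obtain_subset_with_card_n by metis
    then have "insert i S \<in> ?D" using assms by (subst mem_Collect_eq, subst card_insert_disjoint) auto
    from member_le_sum[OF this, of "\<lambda>S. if i \<in> S then (norm (w i))\<^sup>2 else 0"]
    show ?thesis by simp
  qed
  then have "(\<Sum>i\<in>UNIV. (norm (w i))\<^sup>2) \<le> (\<Sum>i\<in>UNIV. \<Sum>S\<in>?D. if i \<in> S then (norm (w i))\<^sup>2 else 0)"
    by (rule sum_mono)
  also have "\<dots> = (\<Sum>S\<in>?D. \<Sum>i\<in>UNIV. if i \<in> S then (norm (w i))\<^sup>2 else 0)"
    by (rule sum.swap)
  also have "\<dots> = (\<Sum>S\<in>?D. \<Sum>i\<in>S. (norm (w i))\<^sup>2)"
    by (simp add: sum.If_cases)
  finally show ?thesis by (simp only: norm_batch_vec)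
qed

context strongly_convex_function
begin

text \<open>
Here \<open>L\<close> is the slope that \<open>minimal_value_lsc\<close> provides for \<open>\<epsilon>\<close>, and the remaining part of the gap is
\<open>\<xi>\<^sub>n (x\<^sub>n - u)\<close>, where \<open>A (x\<^sub>n - u) = A x\<^sub>n - y\<close>.
\<close>

lemma dual_gap_le_residual:
  fixes A :: "'p::finite \<Rightarrow> 'x \<Rightarrow>\<^sub>L 'y::real_inner"
  assumes bounds: "step_bounds \<sigma> b A rule q T c K"
    and J: "\<And>n. card (J n) = b" and noise: "\<And>i. norm (v i - y i) \<le> \<delta> i"
    and u: "\<And>i. A i u = y i"
    and L: "\<And>z. z \<in> effective_domain R \<Longrightarrow>
        rval R u - rval R z \<le> \<epsilon> + L * norm (batch_op A UNIV z - batch_vec UNIV y)"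
  defines "f \<equiv> \<lambda>n. norm (batch_op A UNIV (smd_primal R A rule \<delta> v J n) - batch_vec UNIV y)"
  shows "dual_gap (smd_dual R A rule \<delta> v J n) u
    \<le> \<epsilon> + (L + T * (\<Sum>j<n. f j + noise_level \<delta> UNIV)) * f n"
proof -
  let ?\<xi> = "smd_dual R A rule \<delta> v J n" and ?x = "smd_primal R A rule \<delta> v J n"
  have "batch_op A UNIV (?x - u) = batch_op A UNIV ?x - batch_vec UNIV y"
    using u by (simp add: blinfun.diff_right blinfun_apply_batch_op[of _ _ u])
  then have "?\<xi> (?x - u) \<le> T * (\<Sum>j<n. f j + noise_level \<delta> UNIV) * f n"
    using smd_dual_pairing_le[where z = "?x - u" and n = n and R = R, OF bounds J noise]
    by (simp add: f_def abs_le_iff)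
  moreover have "rval R u - rval R ?x \<le> \<epsilon> + L * f n"
    unfolding f_def by (rule L) (simp add: smd_primal_def mirror_map_in_domain)
  moreover have "dual_gap ?\<xi> u = rval R u - rval R ?x + ?\<xi> (?x - u)"
    by (simp add: dual_gap_def smd_primal_def blinfun.diff_right)
  ultimately show ?thesis by (simp add: distrib_right)
qed

lemma dual_gap_descent:
  fixes A :: "'p::finite \<Rightarrow> 'x \<Rightarrow>\<^sub>L 'y::real_inner"
  assumes bounds: "step_bounds \<sigma> b A rule q T c K"
    and J: "card (J n) = b" and noise: "\<And>i. norm (v i - y i) \<le> \<delta> i"
    and u: "\<And>i. A i u = y i"
  shows "dual_gap (smd_dual R A rule \<delta> v J (Suc n)) u
    \<le> dual_gap (smd_dual R A rule \<delta> v J n) u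
      - (1 - q) * c / 4 * (norm (batch_op A (J n) (smd_primal R A rule \<delta> v J n) - batch_vec (J n) y))\<^sup>2
      + (T / (2 * (1 - q)) + (1 - q) * c * (K + 1) / 2) * (noise_level \<delta> UNIV)\<^sup>2"
proof -
  define \<xi> where "\<xi> = smd_dual R A rule \<delta> v J n"
  define r where "r = batch_op A (J n) (mirror_map R \<xi>) - batch_vec (J n) v"
  define t where "t = step_size rule A \<delta> (J n) r"
  define d where "d = noise_level \<delta> UNIV"
  have sd: "smd_dual R A rule \<delta> v J (Suc n) = \<xi> - t *\<^sub>R dual_adjoint (batch_op A (J n)) r"
    by (simp add: Let_def t_def r_def \<xi>_def)
  have q: "0 \<le> q" "q < 1" and c: "0 < c" and K: "0 \<le> K"
    and t: "0 \<le> t" "t \<le> T"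
    and up: "t * (norm (dual_adjoint (batch_op A (J n)) r))\<^sup>2 \<le> 4 * \<sigma> * q * (norm r)\<^sup>2"
    and low: "c * ((norm r)\<^sup>2 - K * (noise_level \<delta> (J n))\<^sup>2) \<le> t * (norm r)\<^sup>2"
    using bounds J unfolding step_bounds_def t_def by auto
  have nl: "noise_level \<delta> (J n) \<le> d" unfolding d_def by (rule noise_level_mono) simp
  then have "K * (noise_level \<delta> (J n))\<^sup>2 \<le> K * d\<^sup>2"
    using K noise_level_nonneg by (intro mult_left_mono power_mono)
  then have "c * ((norm r)\<^sup>2 - K * d\<^sup>2) \<le> c * ((norm r)\<^sup>2 - K * (noise_level \<delta> (J n))\<^sup>2)"
    using c by (intro mult_left_mono) auto
  with low have low': "c * ((norm r)\<^sup>2 - K * d\<^sup>2) \<le> t * (norm r)\<^sup>2" by linarith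
  have w: "norm (batch_vec (J n) (\<lambda>i. v i - y i)) \<le> d"
    using norm_batch_noise_le[OF noise] nl by (rule order_trans)
  have r: "r = batch_op A (J n) (mirror_map R \<xi>) - batch_vec (J n) y - batch_vec (J n) (\<lambda>i. v i - y i)"
    by (auto simp: r_def batch_vec_def vec_eq_iff)
  have "batch_op A (J n) u = batch_vec (J n) y" using u by (simp add: blinfun_apply_batch_op)
  from dual_gap_step[OF this w t q less_imp_le[OF c] K r up low']
  show ?thesis unfolding sd by (simp add: \<xi>_def smd_primal_def d_def)
qed

end

section \<open>Descent sequences with vanishing perturbation\<close>

lemma perturbed_descent_telescope:
  fixes e a :: "nat \<Rightarrow> real"
  assumes "\<And>n. e (Suc n) \<le> e n - \<kappa> * (a n)\<^sup>2 + D"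
  shows "e n + \<kappa> * (\<Sum>j<n. (a j)\<^sup>2) \<le> e 0 + D * real n"
proof (induction n)
  case (Suc n)
  then show ?case using assms[of n] by (simp add: algebra_simps)
qed simp

text \<open>
The time \<open>M\<close> may depend only on the constants and on \<open>\<epsilon>\<close>, not on the sequences or the perturbation \<open>d\<close>.
Summing the descent inequality bounds \<open>\<Sum> a\<^sub>j\<^sup>2\<close> by \<open>K\<close> as long as \<open>d\<^sup>2 n \<le> 1\<close>, and then the factor in
front of \<open>a n\<close> is at most \<open>B \<surd>(n + 1)\<close>. If \<open>e n > 2 \<epsilon>\<close> for all \<open>n < M\<close>, then
\<open>a\<^sub>n\<^sup>2 \<ge> \<epsilon>\<^sup>2 / (B\<^sup>2 (n + 1))\<close>, and the harmonic series makes this impossible for large \<open>M\<close>. Once the value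
\<open>2 \<epsilon>\<close> has been reached, the perturbations can only add up to \<open>C d\<^sup>2 N\<close>.
\<close>

lemma perturbed_descent_uniform_decay:
  fixes \<kappa> C T L E0 \<epsilon> :: real
  assumes "0 < \<kappa>" "0 \<le> C" "0 \<le> T" "0 \<le> L" "0 < \<epsilon>"
  shows "\<exists>M. \<forall>e a d N. 0 \<le> d \<longrightarrow> (\<forall>n. 0 \<le> e n) \<longrightarrow> (\<forall>n. 0 \<le> a n) \<longrightarrow> e 0 \<le> E0 \<longrightarrow>
      (\<forall>n. e (Suc n) \<le> e n - \<kappa> * (a n)\<^sup>2 + C * d\<^sup>2) \<longrightarrow>
      (\<forall>n. e n \<le> \<epsilon> + (L + T * (\<Sum>j<n. a j + d)) * a n) \<longrightarrow>
      M \<le> N \<longrightarrow> d\<^sup>2 * real N \<le> 1 \<longrightarrow> e N \<le> 2 * \<epsilon> + C * (d\<^sup>2 * real N)"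
proof -
  define K where "K = (\<bar>E0\<bar> + C) / \<kappa>"
  \<comment> \<open>The summand \<open>1\<close> only serves to make \<open>B\<close> positive.\<close>
  define B where "B = L + T * (sqrt K + 1) + 1"
  have K: "0 \<le> K" using assms by (simp add: K_def)
  have B: "0 < B" using assms K by (simp add: B_def add_nonneg_pos)
  have "\<forall>\<^sub>F n in sequentially. K * B\<^sup>2 / \<epsilon>\<^sup>2 < harm n"
    using harm_at_top by (simp add: filterlim_at_top_dense)
  then obtain M where M: "K * B\<^sup>2 / \<epsilon>\<^sup>2 < harm M"
    using eventually_happens'[OF sequentially_bot] by blast
  have "e N \<le> 2 * \<epsilon> + C * (d\<^sup>2 * real N)"
    if d: "0 \<le> d" and e: "\<And>n. 0 \<le> e n" and a: "\<And>n. 0 \<le> a n" and e0: "e 0 \<le> E0"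
      and desc: "\<And>n. e (Suc n) \<le> e n - \<kappa> * (a n)\<^sup>2 + C * d\<^sup>2"
      and bound: "\<And>n. e n \<le> \<epsilon> + (L + T * (\<Sum>j<n. a j + d)) * a n"
      and N: "M \<le> N" "d\<^sup>2 * real N \<le> 1" for e a :: "nat \<Rightarrow> real" and d N
  proof -
    have dn: "d\<^sup>2 * real n \<le> 1" if "n \<le> M" for n
    proof -
      have "d\<^sup>2 * real n \<le> d\<^sup>2 * real N" using that N(1) by (intro mult_left_mono) auto
      then show ?thesis using N(2) by simp
    qed
    have sum_sq: "(\<Sum>j<n. (a j)\<^sup>2) \<le> K" if "n \<le> M" for n
    proof -
      have "e n + \<kappa> * (\<Sum>j<n. (a j)\<^sup>2) \<le> e 0 + C * d\<^sup>2 * real n"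
        using desc by (rule perturbed_descent_telescope)
      moreover have "C * (d\<^sup>2 * real n) \<le> C * 1"
        using dn[OF that] assms by (intro mult_left_mono)
      ultimately have "\<kappa> * (\<Sum>j<n. (a j)\<^sup>2) \<le> \<bar>E0\<bar> + C"
        using e[of n] e0 by (simp add: mult.assoc)
      then show ?thesis using assms by (simp add: K_def field_simps)
    qed
    have sum_le: "L + T * (\<Sum>j<n. a j + d) \<le> B * sqrt (real (Suc n))" if "n \<le> M" for n
    proof -
      have "(\<Sum>j<n. a j)\<^sup>2 \<le> K * real n"
      proof -
        have "(\<Sum>j<n. a j)\<^sup>2 \<le> (\<Sum>j<n. (a j)\<^sup>2) * (\<Sum>j<n. 1\<^sup>2)"
          using Cauchy_Schwarz_ineq_sum[of a "\<lambda>_. 1" "{..<n}"] by simp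
        also have "\<dots> \<le> K * real n"
          using sum_sq[OF that] by (simp add: mult_right_mono)
        finally show ?thesis .
      qed
      then have 1: "(\<Sum>j<n. a j) \<le> sqrt K * sqrt (real n)"
        by (metis real_le_rsqrt real_sqrt_mult)
      \<comment> \<open>The accumulated noise \<open>n d\<close> is of the same order as the sum of the residuals.\<close>
      have 2: "real n * d \<le> sqrt (real n)"
      proof (rule real_le_rsqrt)
        have "(real n * d)\<^sup>2 = real n * (d\<^sup>2 * real n)" by (simp add: power2_eq_square)
        also have "\<dots> \<le> real n * 1" using dn[OF that] by (intro mult_left_mono) auto
        finally show "(real n * d)\<^sup>2 \<le> real n" by simp
      qed
      have "(\<Sum>j<n. a j + d) \<le> (sqrt K + 1) * sqrt (real n)"
        using 1 2 by (simp add: sum.distrib algebra_simps)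
      also have "\<dots> \<le> (sqrt K + 1) * sqrt (real (Suc n))"
        using K by (intro mult_left_mono) auto
      finally have "T * (\<Sum>j<n. a j + d) \<le> T * ((sqrt K + 1) * sqrt (real (Suc n)))"
        using assms by (intro mult_left_mono)
      moreover have "(L + 1) * 1 \<le> (L + 1) * sqrt (real (Suc n))"
        using assms by (intro mult_left_mono) auto
      ultimately show ?thesis by (simp add: B_def algebra_simps)
    qed
    have "\<exists>n<M. e n \<le> 2 * \<epsilon>"
    proof (rule ccontr)
      assume "\<not> ?thesis"
      then have large: "2 * \<epsilon> < e n" if "n < M" for n using that by force
      have "\<epsilon>\<^sup>2 / B\<^sup>2 * inverse (real (Suc n)) \<le> (a n)\<^sup>2" if "n < M" for n
      proof -
        have "\<epsilon> \<le> (L + T * (\<Sum>j<n. a j + d)) * a n"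
          using bound[of n] large[OF that] by linarith
        also have "\<dots> \<le> B * sqrt (real (Suc n)) * a n"
          using sum_le[of n] that a by (intro mult_right_mono) auto
        finally have "\<epsilon>\<^sup>2 \<le> (B * sqrt (real (Suc n)) * a n)\<^sup>2"
          using assms by (intro power_mono) auto
        also have "\<dots> = B\<^sup>2 * real (Suc n) * (a n)\<^sup>2"
          by (simp add: power_mult_distrib)
        finally have "\<epsilon>\<^sup>2 / (B\<^sup>2 * real (Suc n)) \<le> (a n)\<^sup>2"
          using B by (subst pos_divide_le_eq) (simp_all add: mult_ac)
        then show ?thesis by (simp only: inverse_eq_divide times_divide_times_eq mult_1_right)
      qed
      then have "\<epsilon>\<^sup>2 / B\<^sup>2 * harm M \<le> (\<Sum>n<M. (a n)\<^sup>2)"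
        unfolding harm_altdef sum_distrib_left by (intro sum_mono) auto
      then have "\<epsilon>\<^sup>2 / B\<^sup>2 * harm M \<le> K" using sum_sq[of M] by simp
      moreover have "\<epsilon>\<^sup>2 / B\<^sup>2 * (K * B\<^sup>2 / \<epsilon>\<^sup>2) < \<epsilon>\<^sup>2 / B\<^sup>2 * harm M"
        using M assms B by (intro mult_strict_left_mono) auto
      ultimately show False using assms B by simp
    qed
    then obtain n where n: "n < M" "e n \<le> 2 * \<epsilon>" by blast
    \<comment> \<open>From \<open>n\<close> on, descent up to the perturbation carries the bound to time \<open>N\<close>.\<close>
    have "e (n + k) \<le> e n + C * d\<^sup>2 * real k" for k
    proof (induction k)
      case (Suc k)
      have "0 \<le> \<kappa> * (a (n + k))\<^sup>2" using assms by simp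
      then show ?case using Suc desc[of "n + k"] by (simp add: algebra_simps)
    qed simp
    from this[of "N - n"] have "e N \<le> e n + C * (d\<^sup>2 * real (N - n))"
      using n N by (simp add: mult.assoc)
    also have "C * (d\<^sup>2 * real (N - n)) \<le> C * (d\<^sup>2 * real N)"
      using assms by (intro mult_left_mono) auto
    finally show ?thesis using n by simp
  qed
  then show ?thesis by blast
qed

section \<open>Expectations over random batches\<close>

context prob_space
begin

lemma integrable_simple:
  fixes f :: "'a \<Rightarrow> real"
  assumes "simple_function M f"
  shows "integrable M f"
proof (rule integrable_const_bound)
  have "finite (f ` space M)" using assms by (rule simple_functionD)
  then show "AE \<omega> in M. norm (f \<omega>) \<le> Max (norm ` f ` space M)"
    by (intro AE_I2 Max_ge) auto
  show "f \<in> borel_measurable M" using assms by (rule borel_measurable_simple_function)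
qed

lemma expectation_Cauchy_Schwarz:
  fixes f g :: "'a \<Rightarrow> real"
  assumes f: "simple_function M f" and g: "simple_function M g"
  shows "expectation (\<lambda>\<omega>. f \<omega> * g \<omega>) \<le> sqrt (expectation (\<lambda>\<omega>. (f \<omega>)\<^sup>2)) * sqrt (expectation (\<lambda>\<omega>. (g \<omega>)\<^sup>2))"
proof -
  let ?a = "expectation (\<lambda>\<omega>. (f \<omega>)\<^sup>2)" and ?b = "expectation (\<lambda>\<omega>. (g \<omega>)\<^sup>2)"
    and ?c = "expectation (\<lambda>\<omega>. f \<omega> * g \<omega>)"
  have int: "integrable M (\<lambda>\<omega>. (f \<omega>)\<^sup>2)" "integrable M (\<lambda>\<omega>. (g \<omega>)\<^sup>2)" "integrable M (\<lambda>\<omega>. f \<omega> * g \<omega>)"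
    by (auto intro!: integrable_simple simple_function_compose1[OF f] simple_function_compose1[OF g]
        simple_function_compose2[OF f g])
  have quad: "0 \<le> ?a * s\<^sup>2 - 2 * ?c * s + ?b" for s
  proof -
    have "0 \<le> expectation (\<lambda>\<omega>. (s * f \<omega> - g \<omega>)\<^sup>2)" by simp
    also have "(\<lambda>\<omega>. (s * f \<omega> - g \<omega>)\<^sup>2) = (\<lambda>\<omega>. s\<^sup>2 * (f \<omega>)\<^sup>2 - 2 * s * (f \<omega> * g \<omega>) + (g \<omega>)\<^sup>2)"
      by (simp add: power2_eq_square algebra_simps)
    also have "expectation \<dots> = s\<^sup>2 * ?a - 2 * s * ?c + ?b"
      using int by simp
    finally show ?thesis by (simp add: mult_ac)
  qed
  have a: "0 \<le> ?a" by simp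
  have "?c\<^sup>2 \<le> ?a * ?b"
  proof (cases "?a = 0")
    case True
    have "?c = 0"
    proof (rule ccontr)
      assume "?c \<noteq> 0"
      with quad[of "(?b + 1) / (2 * ?c)"] True show False by simp
    qed
    then show ?thesis using True by simp
  next
    case False
    with a have "0 < ?a" by linarith
    have "0 \<le> ?a * (?a * (?c / ?a)\<^sup>2 - 2 * ?c * (?c / ?a) + ?b)"
      using a quad by (intro mult_nonneg_nonneg)
    also have "\<dots> = ?a * ?b - ?c\<^sup>2"
      using \<open>0 < ?a\<close> by (simp add: power2_eq_square field_simps)
    finally show ?thesis by simp
  qed
  then show ?thesis by (metis real_le_rsqrt real_sqrt_mult)
qed

end

text \<open>
Stated for an arbitrary measure space: it serves both for the probability space, where it makes all
random variables below simple and hence integrable, and for the space of finite batch sequences, where it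
gives the measurability that independence arguments need.
\<close>

lemma simple_function_smd_dual:
  assumes "\<And>j. j < n \<Longrightarrow> simple_function M (I j)"
  shows "simple_function M (\<lambda>\<omega>. smd_dual R A rule \<delta> y (\<lambda>n. I n \<omega>) n)"
  using assms
proof (induction n)
  case (Suc n)
  then have "simple_function M (\<lambda>\<omega>. smd_dual R A rule \<delta> y (\<lambda>n. I n \<omega>) n)" "simple_function M (I n)"
    by auto
  from simple_function_compose2[OF this, of "\<lambda>\<xi> S. let T = batch_op A S;
      r = blinfun_apply T (mirror_map R \<xi>) - batch_vec S y in \<xi> - step_size rule A \<delta> S r *\<^sub>R dual_adjoint T r"]
  show ?case by (simp add: Let_def)
qed simp

lemma smd_dual_cong:
  assumes "\<And>j. j < n \<Longrightarrow> J j = J' j"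
  shows "smd_dual R A rule \<delta> y J n = smd_dual R A rule \<delta> y J' n"
  using assms by (induction n) (auto simp: Let_def)

lemma batches_exist: "b \<le> CARD('p) \<Longrightarrow> {S :: 'p::finite set. card S = b} \<noteq> {}"
  using obtain_subset_with_card_n[of b "UNIV :: 'p set"] by auto

context prob_space
begin

context
  fixes b :: nat and I :: "nat \<Rightarrow> 'a \<Rightarrow> 'p::finite set"
  assumes batches: "random_batches M b I" and b: "b \<le> CARD('p)"
begin

lemma batches_indep: "indep_vars (\<lambda>_. count_space UNIV) I UNIV"
  and batches_distr: "distr M (count_space UNIV) (I n) = measure_pmf (pmf_of_set {S. card S = b})"
  using batches by (auto simp: random_batches_def)

lemma batches_measurable: "I n \<in> measurable M (count_space UNIV)"
  using batches_indep by (auto simp: indep_vars_def)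

lemma batches_simple: "simple_function M (I n)"
proof -
  have "I n -` {S} \<inter> space M \<in> sets M" for S
    using batches_measurable by (rule measurable_sets) simp
  then show ?thesis by (auto simp: simple_function_def)
qed

lemma AE_batch_card: "AE \<omega> in M. \<forall>n. card (I n \<omega>) = b"
  unfolding AE_all_countable
proof
  fix n
  have "AE S in distr M (count_space UNIV) (I n). card S = b"
    unfolding batches_distr AE_measure_pmf_iff using batches_exist[OF b] by simp
  from AE_distrD[OF batches_measurable this] show "AE \<omega> in M. card (I n \<omega>) = b" .
qed

lemma prob_batch:
  assumes "card S = b"
  shows "prob {\<omega> \<in> space M. I n \<omega> = S} = 1 / real (card {S :: 'p set. card S = b})"
proof -
  have "prob {\<omega> \<in> space M. I n \<omega> = S} = measure (distr M (count_space UNIV) (I n)) {S}"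
    by (subst measure_distr[OF batches_measurable]) (auto intro!: arg_cong[of _ _ prob])
  also have "\<dots> = pmf (pmf_of_set {S :: 'p set. card S = b}) S"
    unfolding batches_distr by (simp add: measure_pmf_single)
  finally show ?thesis
    using batches_exist[OF b] assms by (simp add: indicator_def)
qed

text \<open>
The dual iterate at time \<open>n\<close> is a function of the first \<open>n\<close> batches, hence independent of the \<open>n\<close>-th batch,
which is uniformly distributed. Since batches take finitely many values, conditioning amounts to
splitting the expectation according to the value of \<open>I n\<close>.
\<close>

lemma expectation_next_batch:
  fixes g :: "('x::banach \<Rightarrow>\<^sub>L real) \<Rightarrow> 'p set \<Rightarrow> real" and A :: "'p \<Rightarrow> 'x \<Rightarrow>\<^sub>L 'y::real_inner"
    and R rule \<delta> y n
  defines "\<Xi> \<equiv> \<lambda>\<omega>. smd_dual R A rule \<delta> y (\<lambda>n. I n \<omega>) n"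
  shows "expectation (\<lambda>\<omega>. g (\<Xi> \<omega>) (I n \<omega>))
    = (\<Sum>S | card S = b. expectation (\<lambda>\<omega>. g (\<Xi> \<omega>) S)) / real (card {S :: 'p set. card S = b})"
proof -
  let ?D = "{S :: 'p set. card S = b}"
  let ?P = "PiM {..<n} (\<lambda>_. count_space UNIV) :: (nat \<Rightarrow> 'p set) measure"
  let ?P' = "PiM {n} (\<lambda>_. count_space UNIV) :: (nat \<Rightarrow> 'p set) measure"
  define ind where "ind S \<omega> = indicat_real {S} (I n \<omega>)" for S \<omega>
  have simple_\<Xi>: "simple_function M \<Xi>"
    unfolding \<Xi>_def by (intro simple_function_smd_dual batches_simple)
  have simple_g: "simple_function M (\<lambda>\<omega>. g (\<Xi> \<omega>) S)" for S
    using simple_\<Xi> by (rule simple_function_compose1)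
  have simple_ind: "simple_function M (ind S)" for S
    unfolding ind_def by (rule simple_function_compose1[OF batches_simple])
  have split: "expectation (\<lambda>\<omega>. g (\<Xi> \<omega>) S * ind S \<omega>) = expectation (\<lambda>\<omega>. g (\<Xi> \<omega>) S) / real (card ?D)"
    if S: "card S = b" for S
  proof -
    have indep: "indep_var ?P (\<lambda>\<omega>. restrict (\<lambda>i. I i \<omega>) {..<n}) ?P' (\<lambda>\<omega>. restrict (\<lambda>i. I i \<omega>) {n})"
      by (rule indep_var_restrict[OF batches_indep]) auto
    have meas_g: "(\<lambda>J. g (smd_dual R A rule \<delta> y J n) S) \<in> borel_measurable ?P"
    proof (rule borel_measurable_simple_function, rule simple_function_compose1[where g = "\<lambda>\<xi>. g \<xi> S"])
      have "simple_function ?P (\<lambda>J. J j)" if "j < n" for j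
      proof -
        have "(\<lambda>J. J j) \<in> measurable ?P (count_space UNIV)"
          using that by (intro measurable_component_singleton) auto
        then have "(\<lambda>J. J j) -` {S} \<inter> space ?P \<in> sets ?P" for S
          by (rule measurable_sets) simp
        then show ?thesis by (auto simp: simple_function_def)
      qed
      then show "simple_function ?P (\<lambda>J. smd_dual R A rule \<delta> y J n)"
        by (rule simple_function_smd_dual)
    qed
    have meas_ind: "(\<lambda>J. indicat_real {S} (J n)) \<in> borel_measurable ?P'"
    proof (rule measurable_compose[where f = "\<lambda>J. J n" and g = "indicat_real {S}"])
      show "(\<lambda>J. J n) \<in> measurable ?P' (count_space UNIV)"
        by (intro measurable_component_singleton) simp
    qed simp
    have "indep_var borel ((\<lambda>J. g (smd_dual R A rule \<delta> y J n) S) \<circ> (\<lambda>\<omega>. restrict (\<lambda>i. I i \<omega>) {..<n}))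
        borel ((\<lambda>J. indicat_real {S} (J n)) \<circ> (\<lambda>\<omega>. restrict (\<lambda>i. I i \<omega>) {n}))"
      by (rule indep_var_compose[OF indep meas_g meas_ind])
    moreover have "smd_dual R A rule \<delta> y (restrict (\<lambda>i. I i \<omega>) {..<n}) n = \<Xi> \<omega>" for \<omega>
      unfolding \<Xi>_def by (rule smd_dual_cong) simp
    ultimately have "indep_var borel (\<lambda>\<omega>. g (\<Xi> \<omega>) S) borel (ind S)"
      by (simp add: comp_def ind_def[abs_def])
    then have "expectation (\<lambda>\<omega>. g (\<Xi> \<omega>) S * ind S \<omega>)
        = expectation (\<lambda>\<omega>. g (\<Xi> \<omega>) S) * expectation (ind S)"
      by (intro indep_var_lebesgue_integral integrable_simple simple_g simple_ind)
    moreover have "expectation (ind S) = prob {\<omega> \<in> space M. I n \<omega> = S}"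
    proof -
      have "expectation (ind S) = expectation (indicat_real {\<omega> \<in> space M. I n \<omega> = S})"
        by (intro Bochner_Integration.integral_cong) (auto simp: ind_def indicator_def)
      moreover have "{\<omega> \<in> space M. I n \<omega> = S} \<inter> space M = {\<omega> \<in> space M. I n \<omega> = S}" by auto
      ultimately show ?thesis by simp
    qed
    ultimately show ?thesis using prob_batch[OF S] by simp
  qed
  have "expectation (\<lambda>\<omega>. g (\<Xi> \<omega>) (I n \<omega>)) = expectation (\<lambda>\<omega>. \<Sum>S\<in>?D. g (\<Xi> \<omega>) S * ind S \<omega>)"
  proof (rule integral_cong_AE)
    show "AE \<omega> in M. g (\<Xi> \<omega>) (I n \<omega>) = (\<Sum>S\<in>?D. g (\<Xi> \<omega>) S * ind S \<omega>)"
      using AE_batch_card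
    proof eventually_elim
      case (elim \<omega>)
      have "(\<Sum>S\<in>?D. g (\<Xi> \<omega>) S * ind S \<omega>) = (\<Sum>S\<in>?D. if S = I n \<omega> then g (\<Xi> \<omega>) S else 0)"
        by (intro sum.cong) (auto simp: ind_def)
      then show ?case using elim by simp
    qed
    show "(\<lambda>\<omega>. g (\<Xi> \<omega>) (I n \<omega>)) \<in> borel_measurable M"
      by (intro borel_measurable_simple_function simple_function_compose2[OF simple_\<Xi> batches_simple])
    show "(\<lambda>\<omega>. \<Sum>S\<in>?D. g (\<Xi> \<omega>) S * ind S \<omega>) \<in> borel_measurable M"
      by (intro borel_measurable_simple_function simple_function_sum simple_function_mult simple_g simple_ind)
  qed
  also have "\<dots> = (\<Sum>S\<in>?D. expectation (\<lambda>\<omega>. g (\<Xi> \<omega>) S * ind S \<omega>))"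
    by (intro Bochner_Integration.integral_sum integrable_simple simple_function_mult simple_g simple_ind)
  also have "\<dots> = (\<Sum>S\<in>?D. expectation (\<lambda>\<omega>. g (\<Xi> \<omega>) S) / real (card ?D))"
    using split by (intro sum.cong) auto
  finally show ?thesis by (simp add: sum_divide_distrib)
qed

end
end

section \<open>Decay of the expected dual gap\<close>

context strongly_convex_function
begin

text \<open>
The constant \<open>C\<close> and the time \<open>m\<close> are the same for all noise levels and all noisy data, which is what
permits the coupling \<open>n = n\<^sub>\<delta>\<close>.
\<close>

lemma expected_dual_gap_uniform_decay:
  fixes A :: "'p::finite \<Rightarrow> 'x \<Rightarrow>\<^sub>L 'y::real_inner" and M :: "'w measure"
  assumes M: "prob_space M" and batches: "random_batches M b I" and b: "1 \<le> b" "b \<le> CARD('p)"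
    and adm: "admissible_rule \<sigma> b A rule"
    and u: "u \<in> effective_domain R" "\<And>i. A i u = y i"
    and u_least: "\<And>z. (\<And>i. A i z = y i) \<Longrightarrow> z \<in> effective_domain R \<Longrightarrow> rval R u \<le> rval R z"
  shows "\<exists>C\<ge>0. \<forall>\<epsilon>>0. \<exists>m. \<forall>\<delta> v n. (\<forall>i. norm (v i - y i) \<le> \<delta> i) \<longrightarrow> m \<le> n \<longrightarrow>
      (noise_level \<delta> UNIV)\<^sup>2 * real n \<le> 1 \<longrightarrow>
      (\<integral>\<omega>. dual_gap (smd_dual R A rule \<delta> v (\<lambda>n. I n \<omega>) n) u \<partial>M)
        \<le> 2 * \<epsilon> + C * ((noise_level \<delta> UNIV)\<^sup>2 * real n)"
proof -
  interpret prob_space M by (rule M)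
  let ?D = "{S :: 'p set. card S = b}"
  obtain q T c K where bounds: "step_bounds \<sigma> b A rule q T c K"
    using admissible_rule_step_bounds[OF adm modulus_pos] by blast
  then have q: "0 \<le> q" "q < 1" and T: "0 \<le> T" and c: "0 < c" and K: "0 \<le> K"
    by (auto simp: step_bounds_def)
  define \<kappa>0 where "\<kappa>0 = (1 - q) * c / 4"
  define C where "C = T / (2 * (1 - q)) + (1 - q) * c * (K + 1) / 2"
  define \<kappa> where "\<kappa> = \<kappa>0 / real (card ?D)"
  have cardD: "0 < real (card ?D)"
    using batches_exist[OF b(2)] by (simp add: card_gt_0_iff)
  have \<kappa>0: "0 < \<kappa>0" using q c by (simp add: \<kappa>0_def)
  have \<kappa>: "0 < \<kappa>" using \<kappa>0 cardD by (simp add: \<kappa>_def)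
  have C: "0 \<le> C" using q T c K by (simp add: C_def)
  have "\<exists>m. \<forall>\<delta> v n. (\<forall>i. norm (v i - y i) \<le> \<delta> i) \<longrightarrow> m \<le> n \<longrightarrow>
      (noise_level \<delta> UNIV)\<^sup>2 * real n \<le> 1 \<longrightarrow>
      expectation (\<lambda>\<omega>. dual_gap (smd_dual R A rule \<delta> v (\<lambda>n. I n \<omega>) n) u)
        \<le> 2 * \<epsilon> + C * ((noise_level \<delta> UNIV)\<^sup>2 * real n)" if "0 < \<epsilon>" for \<epsilon>
  proof -
    have "batch_op A UNIV z = batch_vec UNIV y \<longleftrightarrow> (\<forall>i. A i z = y i)" for z
      by (auto simp: blinfun_apply_batch_op batch_vec_def vec_eq_iff)
    then obtain L where L: "0 \<le> L" "\<And>z. z \<in> effective_domain R \<Longrightarrow>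
        rval R u - rval R z \<le> \<epsilon> + L * norm (batch_op A UNIV z - batch_vec UNIV y)"
      using minimal_value_lsc[of u "batch_op A UNIV" "batch_vec UNIV y" \<epsilon>] u u_least \<open>0 < \<epsilon>\<close> by metis
    obtain m where m: "\<And>e a d n. 0 \<le> d \<Longrightarrow> (\<And>n. 0 \<le> e n) \<Longrightarrow> (\<And>n. 0 \<le> a n) \<Longrightarrow> e 0 \<le> dual_gap 0 u \<Longrightarrow>
        (\<And>n. e (Suc n) \<le> e n - \<kappa> * (a n)\<^sup>2 + C * d\<^sup>2) \<Longrightarrow>
        (\<And>n. e n \<le> \<epsilon> + (L + T * (\<Sum>j<n. a j + d)) * a n) \<Longrightarrow>
        m \<le> n \<Longrightarrow> d\<^sup>2 * real n \<le> 1 \<Longrightarrow> e n \<le> 2 * \<epsilon> + C * (d\<^sup>2 * real n)"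
      using perturbed_descent_uniform_decay[OF \<kappa> C T L(1) \<open>0 < \<epsilon>\<close>, of "dual_gap 0 u"] by metis
    have "expectation (\<lambda>\<omega>. dual_gap (smd_dual R A rule \<delta> v (\<lambda>n. I n \<omega>) n) u)
        \<le> 2 * \<epsilon> + C * ((noise_level \<delta> UNIV)\<^sup>2 * real n)"
      if noise: "\<And>i. norm (v i - y i) \<le> \<delta> i" and n: "m \<le> n" "(noise_level \<delta> UNIV)\<^sup>2 * real n \<le> 1"
      for \<delta> v n
    proof -
      define \<Xi> where "\<Xi> n \<omega> = smd_dual R A rule \<delta> v (\<lambda>n. I n \<omega>) n" for n \<omega>
      define res where "res S \<xi> = norm (batch_op A S (mirror_map R \<xi>) - batch_vec S y)" for S \<xi>
      define G where "G n \<omega> = dual_gap (\<Xi> n \<omega>) u" for n \<omega>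
      define f where "f n \<omega> = res UNIV (\<Xi> n \<omega>)" for n \<omega>
      define d where "d = noise_level \<delta> UNIV"
      define e where "e n = expectation (G n)" for n
      define a where "a n = sqrt (expectation (\<lambda>\<omega>. (f n \<omega>)\<^sup>2))" for n
      have simple_\<Xi>: "simple_function M (\<Xi> n)" for n
        unfolding \<Xi>_def by (intro simple_function_smd_dual batches_simple[OF batches b(2)])
      have simple_G: "simple_function M (G n)" for n
        unfolding G_def using simple_\<Xi> by (rule simple_function_compose1)
      have simple_f: "simple_function M (f n)" for n
        unfolding f_def using simple_\<Xi> by (rule simple_function_compose1)
      have a_sq: "(a n)\<^sup>2 = expectation (\<lambda>\<omega>. (f n \<omega>)\<^sup>2)" for n
        unfolding a_def by simp
      have a_nonneg: "0 \<le> a n" for n by (simp add: a_def)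
      have e_nonneg: "0 \<le> e n" for n
        unfolding e_def
      proof (rule Bochner_Integration.integral_nonneg)
        fix \<omega>
        have "0 \<le> \<sigma> * (norm (mirror_map R (\<Xi> n \<omega>) - u))\<^sup>2" using modulus_pos by simp
        also have "\<dots> \<le> G n \<omega>" unfolding G_def by (rule norm_le_dual_gap[OF u(1)])
        finally show "0 \<le> G n \<omega>" .
      qed
      have e0: "e 0 \<le> dual_gap 0 u"
        by (simp add: e_def G_def[abs_def] \<Xi>_def prob_space)
      \<comment> \<open>The descent along a path sees the current batch only; its expectation sees the full residual.\<close>
      have descent: "e (Suc n) \<le> e n - \<kappa> * (a n)\<^sup>2 + C * d\<^sup>2" for n
      proof -
        let ?h = "\<lambda>\<omega>. (res (I n \<omega>) (\<Xi> n \<omega>))\<^sup>2"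
        have simple_h: "simple_function M ?h"
          by (rule simple_function_compose2[OF simple_\<Xi>[of n] batches_simple[OF batches b(2), of n],
                where h = "\<lambda>\<xi> S. (res S \<xi>)\<^sup>2"])
        have "e (Suc n) \<le> expectation (\<lambda>\<omega>. G n \<omega> - \<kappa>0 * ?h \<omega> + C * d\<^sup>2)"
          unfolding e_def
        proof (rule integral_mono_AE)
          show "AE \<omega> in M. G (Suc n) \<omega> \<le> G n \<omega> - \<kappa>0 * ?h \<omega> + C * d\<^sup>2"
            using AE_batch_card[OF batches b(2)]
          proof eventually_elim
            case (elim \<omega>)
            then show ?case
              using dual_gap_descent[where J = "\<lambda>n. I n \<omega>" and n = n and u = u, OF bounds _ noise u(2)]
              by (simp add: G_def \<Xi>_def res_def smd_primal_def \<kappa>0_def C_def d_def del: smd_dual.simps)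
          qed
        qed (use integrable_simple[OF simple_G] integrable_simple[OF simple_h] in simp_all)
        also have "\<dots> = e n - \<kappa>0 * expectation ?h + C * d\<^sup>2"
          using integrable_simple[OF simple_G] integrable_simple[OF simple_h]
          by (simp add: e_def prob_space)
        also have "(a n)\<^sup>2 / real (card ?D) \<le> expectation ?h"
        proof -
          have simple_res: "simple_function M (\<lambda>\<omega>. (res S (\<Xi> n \<omega>))\<^sup>2)" for S
            by (rule simple_function_compose1[OF simple_\<Xi>])
          have "(a n)\<^sup>2 \<le> expectation (\<lambda>\<omega>. \<Sum>S\<in>?D. (res S (\<Xi> n \<omega>))\<^sup>2)"
            unfolding a_sq
          proof (rule integral_mono)
            show "(f n \<omega>)\<^sup>2 \<le> (\<Sum>S\<in>?D. (res S (\<Xi> n \<omega>))\<^sup>2)" for \<omega>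
              unfolding f_def res_def batch_op_residual by (rule full_residual_le_sum_batches[OF b])
          qed (intro integrable_simple simple_function_sum simple_res
              simple_function_compose1[OF simple_f])+
          also have "\<dots> = (\<Sum>S\<in>?D. expectation (\<lambda>\<omega>. (res S (\<Xi> n \<omega>))\<^sup>2))"
            by (intro Bochner_Integration.integral_sum integrable_simple simple_res)
          also have "\<dots> / real (card ?D) = expectation ?h"
            using expectation_next_batch[OF batches b(2), where g = "\<lambda>\<xi> S. (res S \<xi>)\<^sup>2" and n = n
                and R = R and A = A and rule = rule and \<delta> = \<delta> and y = v]
            by (simp add: \<Xi>_def)
          finally show ?thesis using cardD by (simp add: divide_right_mono)
        qed
        then have "e n - \<kappa>0 * expectation ?h + C * d\<^sup>2 \<le> e n - \<kappa> * (a n)\<^sup>2 + C * d\<^sup>2"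
          using mult_left_mono[of "(a n)\<^sup>2 / real (card ?D)" "expectation ?h" \<kappa>0] \<kappa>0
          by (simp add: \<kappa>_def)
        finally show ?thesis .
      qed
      \<comment> \<open>The products of residuals at different times are separated by Cauchy-Schwarz.\<close>
      have bound: "e n \<le> \<epsilon> + (L + T * (\<Sum>j<n. a j + d)) * a n" for n
      proof -
        let ?H = "\<lambda>\<omega>. \<epsilon> + L * f n \<omega> + T * (\<Sum>j<n. f j \<omega> * f n \<omega> + d * f n \<omega>)"
        have int_f: "integrable M (f n)" by (rule integrable_simple[OF simple_f])
        have int_ff: "integrable M (\<lambda>\<omega>. f j \<omega> * f n \<omega>)" for j
          by (intro integrable_simple simple_function_mult simple_f)
        have Ef: "expectation (f n) \<le> a n"
          using expectation_Cauchy_Schwarz[of "\<lambda>_. 1" "f n"] simple_f by (simp add: a_def prob_space)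
        have Eff: "expectation (\<lambda>\<omega>. f j \<omega> * f n \<omega>) \<le> a j * a n" for j
          unfolding a_def by (rule expectation_Cauchy_Schwarz[OF simple_f simple_f])
        have "e n \<le> expectation ?H"
          unfolding e_def
        proof (rule integral_mono_AE)
          show "integrable M (G n)" by (rule integrable_simple[OF simple_G])
          show "integrable M ?H" using int_f int_ff by simp
          show "AE \<omega> in M. G n \<omega> \<le> ?H \<omega>"
            using AE_batch_card[OF batches b(2)]
          proof eventually_elim
            case (elim \<omega>)
            have "G n \<omega> \<le> \<epsilon> + (L + T * (\<Sum>j<n. f j \<omega> + d)) * f n \<omega>"
              using dual_gap_le_residual[where J = "\<lambda>n. I n \<omega>" and n = n and u = u and \<epsilon> = \<epsilon> and L = L,
                  OF bounds _ noise u(2) L(2)] elim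
              by (simp add: G_def \<Xi>_def f_def res_def smd_primal_def d_def)
            also have "\<dots> = ?H \<omega>"
              by (simp add: distrib_right sum_distrib_right mult.assoc)
            finally show ?case .
          qed
        qed
        also have "\<dots> = \<epsilon> + L * expectation (f n)
            + T * (\<Sum>j<n. expectation (\<lambda>\<omega>. f j \<omega> * f n \<omega>) + d * expectation (f n))"
          using int_f int_ff by (simp add: prob_space)
        also have "\<dots> \<le> \<epsilon> + L * a n + T * (\<Sum>j<n. a j * a n + d * a n)"
          using Ef Eff L(1) T noise_level_nonneg
          by (intro add_mono order_refl mult_left_mono sum_mono) (auto simp: d_def)
        also have "\<dots> = \<epsilon> + (L + T * (\<Sum>j<n. a j + d)) * a n"
          by (simp add: distrib_right sum_distrib_right mult.assoc)
        finally show ?thesis .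
      qed
      have "e n \<le> 2 * \<epsilon> + C * (d\<^sup>2 * real n)"
        using n by (intro m[of d e a, OF _ e_nonneg a_nonneg e0 descent bound])
          (auto simp: d_def noise_level_nonneg)
      then show ?thesis by (simp add: e_def G_def[abs_def] \<Xi>_def d_def)
    qed
    then show ?thesis by blast
  qed
  with C show ?thesis by blast
qed

end

theorem theorem3p4:
  fixes R :: "'x::banach \<Rightarrow> ereal"
    and Y :: "'p::finite \<Rightarrow> ('y::{real_inner, banach}) set"
    and A :: "'p \<Rightarrow> 'x \<Rightarrow>\<^sub>L 'y"
    and y :: "'p \<Rightarrow> 'y"
    and \<sigma> :: real and b :: nat and rule :: "'p step_rule"
    and M :: "'w measure" and I :: "nat \<Rightarrow> 'w \<Rightarrow> 'p set"
    and F :: "'k filter"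
    and \<delta> :: "'k \<Rightarrow> 'p \<Rightarrow> real" and yd :: "'k \<Rightarrow> 'p \<Rightarrow> 'y" and N :: "'k \<Rightarrow> nat"
  assumes "\<And>i. subspace (Y i)" and "\<And>i. closed (Y i)"
    and "\<And>i. range (blinfun_apply (A i)) \<subseteq> Y i"
    and "\<And>i. y i \<in> Y i"
    and "proper_function R" and "lower_semicontinuous R"
    and "0 < \<sigma>" and "modulus_of_convexity R \<sigma>"
    and "\<exists>x \<in> effective_domain R. \<forall>i. blinfun_apply (A i) x = y i"
    and "1 \<le> b" and "b \<le> CARD('p)"
    and "admissible_rule \<sigma> b A rule"
    and "prob_space M" and "random_batches M b I"
    and "\<And>k i. 0 < \<delta> k i"
    and "\<And>k i. yd k i \<in> Y i"
    and "\<And>k i. norm (yd k i - y i) \<le> \<delta> k i"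
    and "((\<lambda>k. noise_level (\<delta> k) UNIV) \<longlongrightarrow> 0) F"
    and "filterlim N at_top F"
    and "((\<lambda>k. (noise_level (\<delta> k) UNIV)\<^sup>2 * real (N k)) \<longlongrightarrow> 0) F"
  defines "xdag \<equiv> minimizing_solution R A y"
    and "x \<equiv> \<lambda>k \<omega>. smd_primal R A rule (\<delta> k) (yd k) (\<lambda>n. I n \<omega>) (N k)"
    and "\<xi> \<equiv> \<lambda>k \<omega>. smd_dual R A rule (\<delta> k) (yd k) (\<lambda>n. I n \<omega>) (N k)"
  shows "((\<lambda>k. prob_space.expectation M (\<lambda>\<omega>. (norm (x k \<omega> - xdag))\<^sup>2)) \<longlongrightarrow> 0) F
    \<and> ((\<lambda>k. prob_space.expectation M
           (\<lambda>\<omega>. real_of_ereal (bregman_distance R (\<xi> k \<omega>) xdag (x k \<omega>)))) \<longlongrightarrow> 0) F"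
proof -
  interpret prob_space M by fact
  interpret strongly_convex_function R \<sigma>
    using assms(5-8) by unfold_locales (auto simp: modulus_of_convexity_def)
  let ?sol = "\<lambda>x. \<forall>i. blinfun_apply (A i) x = y i"
  have conv: "convex {x. ?sol x}"
  proof (rule convexI)
    fix v w and s t :: real
    assume "v \<in> {x. ?sol x}" "w \<in> {x. ?sol x}" "s + t = 1"
    then show "s *\<^sub>R v + t *\<^sub>R w \<in> {x. ?sol x}"
      by (simp add: blinfun.add_right blinfun.scaleR_right flip: scaleR_left_distrib)
  qed
  have closed: "closed {x. ?sol x}"
    by (intro closed_Collect_all closed_Collect_eq continuous_intros)
  have dag: "A i xdag = y i" "xdag \<in> effective_domain R"
    "(\<And>i. A i z = y i) \<Longrightarrow> z \<in> effective_domain R \<Longrightarrow> rval R xdag \<le> rval R z" for i z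
    using arg_min_minimizes[OF conv closed assms(9)] unfolding xdag_def minimizing_solution_def by blast+
  define G where "G k \<omega> = dual_gap (\<xi> k \<omega>) xdag" for k \<omega>
  have x_eq: "x k \<omega> = mirror_map R (\<xi> k \<omega>)" for k \<omega>
    by (simp add: x_def \<xi>_def smd_primal_def)
  have simple_\<xi>: "simple_function M (\<xi> k)" for k
    unfolding \<xi>_def by (intro simple_function_smd_dual batches_simple[OF assms(14) assms(11)])
  have norm_le: "\<sigma> * (norm (x k \<omega> - xdag))\<^sup>2 \<le> G k \<omega>" for k \<omega>
    unfolding G_def x_eq by (rule norm_le_dual_gap[OF dag(2)])
  have G_nonneg: "0 \<le> G k \<omega>" for k \<omega>
  proof -
    have "0 \<le> \<sigma> * (norm (x k \<omega> - xdag))\<^sup>2" using modulus_pos by simp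
    then show ?thesis using norm_le by (rule order_trans)
  qed
  obtain C where C: "0 \<le> C" "\<And>\<epsilon>. 0 < \<epsilon> \<Longrightarrow> \<exists>m. \<forall>\<delta> v n. (\<forall>i. norm (v i - y i) \<le> \<delta> i) \<longrightarrow> m \<le> n \<longrightarrow>
      (noise_level \<delta> UNIV)\<^sup>2 * real n \<le> 1 \<longrightarrow>
      expectation (\<lambda>\<omega>. dual_gap (smd_dual R A rule \<delta> v (\<lambda>n. I n \<omega>) n) xdag)
        \<le> 2 * \<epsilon> + C * ((noise_level \<delta> UNIV)\<^sup>2 * real n)"
    using expected_dual_gap_uniform_decay[OF assms(13,14,10-12) dag(2,1,3)] by blast
  \<comment> \<open>At accuracy \<open>\<eta> / 4\<close> the uniform bound is \<open>\<eta> / 2\<close> plus a noise contribution below \<open>\<eta> / 2\<close>.\<close>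
  have lim_G: "((\<lambda>k. expectation (G k)) \<longlongrightarrow> 0) F"
  proof (rule order_tendstoI)
    fix l :: real assume "l < 0"
    then show "\<forall>\<^sub>F k in F. l < expectation (G k)"
      by (intro always_eventually allI less_le_trans[OF _ Bochner_Integration.integral_nonneg] G_nonneg)
  next
    fix \<eta> :: real assume "0 < \<eta>"
    then have "0 < \<eta> / 4" by simp
    from C(2)[OF this] obtain m where m: "\<And>\<delta> v n. (\<And>i. norm (v i - y i) \<le> \<delta> i) \<Longrightarrow> m \<le> n \<Longrightarrow>
      (noise_level \<delta> UNIV)\<^sup>2 * real n \<le> 1 \<Longrightarrow>
      expectation (\<lambda>\<omega>. dual_gap (smd_dual R A rule \<delta> v (\<lambda>n. I n \<omega>) n) xdag)
        \<le> 2 * (\<eta> / 4) + C * ((noise_level \<delta> UNIV)\<^sup>2 * real n)"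
      by blast
    have "\<forall>\<^sub>F k in F. m \<le> N k"
      using assms(19) by (simp add: filterlim_at_top)
    moreover have "\<forall>\<^sub>F k in F. (noise_level (\<delta> k) UNIV)\<^sup>2 * real (N k) < 1"
      using assms(20) by (rule order_tendstoD) simp
    moreover have "((\<lambda>k. C * ((noise_level (\<delta> k) UNIV)\<^sup>2 * real (N k))) \<longlongrightarrow> C * 0) F"
      by (intro tendsto_mult_left assms(20))
    then have "\<forall>\<^sub>F k in F. C * ((noise_level (\<delta> k) UNIV)\<^sup>2 * real (N k)) < \<eta> / 2"
      using \<open>0 < \<eta>\<close> by (intro order_tendstoD(2)) auto
    ultimately show "\<forall>\<^sub>F k in F. expectation (G k) < \<eta>"
    proof eventually_elim
      case (elim k)
      have "norm (yd k i - y i) \<le> \<delta> k i" for i by (rule assms(17))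
      from m[OF this, of "N k"] elim show ?case
        by (simp add: G_def[abs_def] \<xi>_def)
    qed
  qed
  have "((\<lambda>k. expectation (\<lambda>\<omega>. (norm (x k \<omega> - xdag))\<^sup>2)) \<longlongrightarrow> 0) F"
  proof (rule tendsto_sandwich[where f = "\<lambda>_. 0" and h = "\<lambda>k. expectation (G k) / \<sigma>"])
    have "expectation (\<lambda>\<omega>. (norm (x k \<omega> - xdag))\<^sup>2) \<le> expectation (G k) / \<sigma>" for k
    proof -
      have "expectation (\<lambda>\<omega>. (norm (x k \<omega> - xdag))\<^sup>2) \<le> expectation (\<lambda>\<omega>. G k \<omega> / \<sigma>)"
      proof (rule integral_mono)
        show "(norm (x k \<omega> - xdag))\<^sup>2 \<le> G k \<omega> / \<sigma>" for \<omega>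
          using norm_le modulus_pos by (simp add: field_simps)
        show "integrable M (\<lambda>\<omega>. (norm (x k \<omega> - xdag))\<^sup>2)" "integrable M (\<lambda>\<omega>. G k \<omega> / \<sigma>)"
          unfolding x_eq G_def by (intro integrable_simple simple_function_compose1[OF simple_\<xi>])+
      qed
      then show ?thesis by simp
    qed
    then show "\<forall>\<^sub>F k in F. expectation (\<lambda>\<omega>. (norm (x k \<omega> - xdag))\<^sup>2) \<le> expectation (G k) / \<sigma>"
      by simp
    show "((\<lambda>k. expectation (G k) / \<sigma>) \<longlongrightarrow> 0) F"
      using tendsto_divide[OF lim_G tendsto_const[of \<sigma>]] modulus_pos by simp
  qed simp_all
  moreover have "real_of_ereal (bregman_distance R (\<xi> k \<omega>) xdag (x k \<omega>)) = G k \<omega>" for k \<omega>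
    unfolding x_eq G_def bregman_distance_eq_dual_gap[OF dag(2)] by simp
  ultimately show ?thesis using lim_G by simp
qed

end
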